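(* Let $q_1,q_2\in(0,1)$ be fixed with $q_1=1-q_2$, and for each $n\ge2$ let $(Z_t)$ be the standard edgelighter walk on a vertex set $V$ with $|V|=n$ and parameters $q_1,q_2$. Let $t^\circ_m$ be the total variation mixing time of $(Z_t)$ and let $t^{(u)}_{\mathrm{cover}}$ be the maximal expected time for the walker to traverse all unordered pairs of distinct vertices. Then for all sufficiently large $n$, $$\tfrac12 n^2\log n\le t^{(u)}_{\mathrm{cover}}\le \tfrac52 n^2\log n,$$ and consequently $t^\circ_m=\Theta(n^2\log n)$.
   Context: Standard edgelighter walk with parameters $q_1,q_2$: a time-homogeneous Markov chain $Z_t=(L_t,G_t)$ on $V\times\{0,1\}^{\binom V2}$, where $L_t\in V$ is the walker's position and $G_t$ is the current graph on $V$ (encoded by the indicator of its edge set). If at time $t$ the walker is at $u$, it selects $v\in V$ uniformly at random ($v=u$ allowed, probability $1/n$ each), independently of the past, and moves to $v$. If $v=u$, then $G_{t+1}=G_t$. If $v\ne u$, only the status of the pair $\{u,v\}$ may change: if $\{u,v\}$ is an edge of $G_t$, it is removed with probability $q_1$ (and kept with probability $1-q_1$); if $\{u,v\}$ is a non-edge of $G_t$, it is added with probability $q_2$ (and left absent with probability $1-q_2$). These random switches are independent of the walker and of the graph history. The chain is ergodic. Cover time: $\tau^{(u)}_{\mathrm{cover}}=\min\{t:\ \text{every pair in }\binom V2\text{ equals }\{L_\ell,L_{\ell+1}\}\text{ for some }0\le\ell\le t-1\}$, and $t^{(u)}_{\mathrm{cover}}=\max_{x\in V}\mathbb{E}_x\,\tau^{(u)}_{\mathrm{cover}}$,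 where $\mathbb{E}_x$ is expectation with $L_0=x$. Mixing time: for an ergodic chain on $S$ with transition function $P$ and stationary distribution $\pi$, $t_m=\min\{t\ge0:\max_{x\in S}\|P^t(x,\cdot)-\pi\|_{TV}<1/4\}$. $f=\Theta(g)$ means $f=O(g)$ and $g=O(f)$ as $n\to\infty$. *)

theory Defs
  imports "HOL-Probability.Probability" "HOL-Library.Landau_Symbols"
begin

primrec kernel_power :: "('s \<Rightarrow> 's pmf) \<Rightarrow> nat \<Rightarrow> 's \<Rightarrow> 's pmf" where
  "kernel_power K 0 x = return_pmf x"
| "kernel_power K (Suc t) x = bind_pmf (kernel_power K t x) K"

definition total_variation :: "'s pmf \<Rightarrow> 's pmf \<Rightarrow> real" where
  "total_variation p q = (SUP A. \<bar>measure_pmf.prob p A - measure_pmf.prob q A\<bar>)"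

definition stationary_distribution :: "'s set \<Rightarrow> ('s \<Rightarrow> 's pmf) \<Rightarrow> 's pmf" where
  "stationary_distribution S K = (THE \<pi>. set_pmf \<pi> \<subseteq> S \<and> bind_pmf \<pi> K = \<pi>)"

text \<open>Intended for kernels that are ergodic on the finite nonempty state space \<open>S\<close>.\<close>

definition mixing_time :: "'s set \<Rightarrow> ('s \<Rightarrow> 's pmf) \<Rightarrow> nat" where
  "mixing_time S K =
     (LEAST t. (MAX x\<in>S. total_variation (kernel_power K t x) (stationary_distribution S K)) < 1/4)"

text \<open>
  The law of the trajectory \<open>\<omega> 0, \<omega> 1, \<dots>\<close> of the chain with kernel \<open>K\<close> started
  at \<open>x\<close>, obtained from the Ionescu-Tulcea construction.  Its
  finite-dimensional distributions are given by \<open>emeasure_markov_path\<close> below.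
\<close>

definition path_kernel :: "('s \<Rightarrow> 's pmf) \<Rightarrow> 's \<Rightarrow> nat \<Rightarrow> (nat \<Rightarrow> 's) \<Rightarrow> 's measure" where
  "path_kernel K x i \<omega> = measure_pmf (case i of 0 \<Rightarrow> return_pmf x | Suc j \<Rightarrow> K (\<omega> j))"

definition markov_path :: "('s \<Rightarrow> 's pmf) \<Rightarrow> 's \<Rightarrow> (nat \<Rightarrow> 's) measure" where
  "markov_path K x =
     projective_family.lim UNIV
       (Ionescu_Tulcea.CI (path_kernel K x) (\<lambda>_. count_space UNIV)) (\<lambda>_. count_space UNIV)"

lemma Ionescu_Tulcea_path_kernel:
  "Ionescu_Tulcea (path_kernel K x) (\<lambda>_. count_space UNIV)"
proof (rule Ionescu_Tulcea.intro)
  fix i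
  show "path_kernel K x i \<in> PiM {0..<i} (\<lambda>_. count_space UNIV) \<rightarrow>\<^sub>M subprob_algebra (count_space UNIV)"
  proof (cases i)
    case 0
    have "path_kernel K x 0 = (\<lambda>_. measure_pmf (return_pmf x))"
      by (simp add: path_kernel_def fun_eq_iff)
    moreover have "measure_pmf (return_pmf x) \<in> space (subprob_algebra (count_space UNIV))"
      using measure_pmf_in_subprob_algebra[of "return_pmf x"] by simp
    ultimately show ?thesis
      using 0 by (simp add: measurable_const)
  next
    case (Suc j)
    have 1: "(\<lambda>\<omega>. \<omega> j) \<in> PiM {0..<i} (\<lambda>_. count_space UNIV) \<rightarrow>\<^sub>M count_space UNIV"
      using Suc by (intro measurable_component_singleton) auto
    have 2: "(\<lambda>y. measure_pmf (K y)) \<in> count_space UNIV \<rightarrow>\<^sub>M subprob_algebra (count_space UNIV)"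
      by (simp add: measure_pmf_in_subprob_algebra)
    have "path_kernel K x i = (\<lambda>\<omega>. measure_pmf (K (\<omega> j)))"
      by (simp add: path_kernel_def fun_eq_iff Suc)
    then show ?thesis
      using measurable_compose[OF 1 2] by simp
  qed
qed (simp add: path_kernel_def measure_pmf.prob_space_axioms)

lemma sets_markov_path: "sets (markov_path K x) = sets (PiM UNIV (\<lambda>_. count_space UNIV))"
proof -
  interpret Ionescu_Tulcea "path_kernel K x" "\<lambda>_. count_space UNIV"
    by (rule Ionescu_Tulcea_path_kernel)
  show ?thesis by (simp add: markov_path_def)
qed

lemma space_markov_path: "space (markov_path K x) = UNIV"
  using sets_eq_imp_space_eq[OF sets_markov_path[of K x]] by (simp add: space_PiM)

lemma vimage_cylinder_0: "(\<lambda>y. (\<lambda>_. undefined)(0 := y)) -` (\<Pi>\<^sub>E i\<in>{0..<Suc 0}. {s i}) = {s 0}"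
  by (intro set_eqI) (simp add: PiE_iff extensional_def)

lemma vimage_cylinder_Suc:
  assumes "\<omega> \<in> extensional {0..<Suc n}"
  shows "(\<lambda>y. fun_upd \<omega> (Suc n) y) -` (\<Pi>\<^sub>E i\<in>{0..<Suc (Suc n)}. {s i}) =
    (if \<omega> \<in> (\<Pi>\<^sub>E i\<in>{0..<Suc n}. {s i}) then {s (Suc n)} else {})"
proof (intro set_eqI)
  fix y
  have "fun_upd \<omega> (Suc n) y \<in> extensional {0..<Suc (Suc n)}"
    using assms by (auto simp: extensional_def)
  moreover have "(\<forall>i\<in>{0..<Suc (Suc n)}. fun_upd \<omega> (Suc n) y i = s i) \<longleftrightarrow>
      y = s (Suc n) \<and> (\<forall>i\<in>{0..<Suc n}. \<omega> i = s i)"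
    by (auto simp: atLeastLessThanSuc[of 0 "Suc n"])
  ultimately show "y \<in> (\<lambda>y. fun_upd \<omega> (Suc n) y) -` (\<Pi>\<^sub>E i\<in>{0..<Suc (Suc n)}. {s i}) \<longleftrightarrow>
      y \<in> (if \<omega> \<in> (\<Pi>\<^sub>E i\<in>{0..<Suc n}. {s i}) then {s (Suc n)} else {})"
    using assms unfolding vimage_eq PiE_iff by (simp del: fun_upd_apply)
qed

lemma emeasure_markov_path:
  "emeasure (markov_path K x) {\<omega>. \<forall>i\<le>n. \<omega> i = s i} =
     (if s 0 = x then ennreal (\<Prod>i<n. pmf (K (s i)) (s (Suc i))) else 0)"
proof -
  let ?M = "\<lambda>_::nat. count_space (UNIV :: 'a set)"
  interpret Ionescu_Tulcea "path_kernel K x" ?M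
    by (rule Ionescu_Tulcea_path_kernel)
  let ?A = "\<lambda>m. \<Pi>\<^sub>E i\<in>{0..<m}. {s i}"
  have A[measurable]: "?A m \<in> sets (PiM {0..<m} ?M)" for m
    by (intro sets_PiM_I_finite) auto
  have und: "(\<lambda>_. undefined) \<in> space (PiM {0..<0} ?M)"
    by (simp add: space_PiM)
  have C: "emeasure (C 0 (Suc n) (\<lambda>_. undefined)) (?A (Suc n)) =
     (if s 0 = x then ennreal (\<Prod>i<n. pmf (K (s i)) (s (Suc i))) else 0)" for n
  proof (induction n)
    case 0
    have "C 0 (Suc 0) (\<lambda>_. undefined) = eP 0 (\<lambda>_. undefined)"
      using bind_return[OF measurable_eP[of 0], of "\<lambda>_. undefined"] by (simp add: space_PiM)
    then have "emeasure (C 0 (Suc 0) (\<lambda>_. undefined)) (?A (Suc 0)) =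
        emeasure (eP 0 (\<lambda>_. undefined)) (?A (Suc 0))"
      by (simp only:)
    also have "\<dots> = emeasure (measure_pmf (return_pmf x))
        ((\<lambda>y. (\<lambda>_. undefined)(0 := y)) -` ?A (Suc 0))"
      using emeasure_eP[OF und A[of "Suc 0"]]
      by (simp only: path_kernel_def nat.case space_count_space Int_UNIV_right)
    also have "(\<lambda>y. (\<lambda>_. undefined)(0 := y)) -` ?A (Suc 0) = {s 0}"
      by (rule vimage_cylinder_0)
    finally show ?case
      by (simp add: emeasure_pmf_single indicator_def)
  next
    case (Suc n)
    let ?C = "C 0 (Suc n) (\<lambda>_. undefined)"
    have sp: "space ?C = space (PiM {0..<Suc n} ?M)"
      using space_C[OF und, of "Suc n"] by simp
    have st: "sets ?C = sets (PiM {0..<Suc n} ?M)"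
      using sets_C[OF und, of "Suc n"] by simp
    have "emeasure (C 0 (Suc (Suc n)) (\<lambda>_. undefined)) (?A (Suc (Suc n))) =
        emeasure (?C \<bind> eP (Suc n)) (?A (Suc (Suc n)))"
      by simp
    also have "\<dots> = (\<integral>\<^sup>+\<omega>. emeasure (eP (Suc n) \<omega>) (?A (Suc (Suc n))) \<partial>?C)"
      using sp st
      by (intro emeasure_bind[where N="PiM {0..<Suc (Suc n)} ?M"])
         (auto simp: measurable_cong_sets[OF st refl] simp del: C.simps)
    also have "\<dots> = (\<integral>\<^sup>+\<omega>. ennreal (pmf (K (s n)) (s (Suc n))) * indicator (?A (Suc n)) \<omega> \<partial>?C)"
    proof (intro nn_integral_cong)
      fix \<omega> assume "\<omega> \<in> space ?C"
      then have \<omega>: "\<omega> \<in> space (PiM {0..<Suc n} ?M)" using sp by simp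
      have eq: "(\<lambda>y. fun_upd \<omega> (Suc n) y) -` ?A (Suc (Suc n)) =
          (if \<omega> \<in> ?A (Suc n) then {s (Suc n)} else {})"
        using \<omega> by (intro vimage_cylinder_Suc) (simp add: space_PiM PiE_iff)
      have "emeasure (eP (Suc n) \<omega>) (?A (Suc (Suc n))) =
          emeasure (measure_pmf (K (\<omega> n))) ((\<lambda>y. fun_upd \<omega> (Suc n) y) -` ?A (Suc (Suc n)))"
        using emeasure_eP[OF \<omega> A[of "Suc (Suc n)"]]
        by (simp only: path_kernel_def nat.case space_count_space Int_UNIV_right)
      also have "\<dots> = ennreal (pmf (K (s n)) (s (Suc n))) * indicator (?A (Suc n)) \<omega>"
        unfolding eq by (auto simp: emeasure_pmf_single PiE_iff)
      finally show "emeasure (eP (Suc n) \<omega>) (?A (Suc (Suc n))) =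
          ennreal (pmf (K (s n)) (s (Suc n))) * indicator (?A (Suc n)) \<omega>" .
    qed
    also have "\<dots> = ennreal (pmf (K (s n)) (s (Suc n))) * emeasure ?C (?A (Suc n))"
      using A[of "Suc n"] st by (subst nn_integral_cmult_indicator) auto
    also have "\<dots> = (if s 0 = x then ennreal (\<Prod>i<Suc n. pmf (K (s i)) (s (Suc i))) else 0)"
      unfolding Suc.IH by (auto simp: ennreal_mult'' prod_nonneg mult.commute)
    finally show ?case .
  qed
  have emb: "{\<omega>. \<forall>i\<le>n. \<omega> i = s i} = PF.emb UNIV {0..<Suc n} (?A (Suc n))"
    by (auto simp: prod_emb_def space_PiM PiE_iff less_Suc_eq_le)
  have "emeasure (markov_path K x) {\<omega>. \<forall>i\<le>n. \<omega> i = s i} = emeasure (CI {0..<Suc n}) (?A (Suc n))"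
    unfolding markov_path_def emb by (rule lim) (use A in auto)
  also have "\<dots> = emeasure (C 0 (Suc n) (\<lambda>_. undefined)) (PF.emb {0..<Suc n} {0..<Suc n} (?A (Suc n)))"
    by (rule emeasure_CI) (use A in auto)
  also have "PF.emb {0..<Suc n} {0..<Suc n} (?A (Suc n)) = ?A (Suc n)"
    by (rule prod_emb_id) (use sets.sets_into_space[OF A] in \<open>simp add: space_PiM\<close>)
  finally show ?thesis
    by (simp only: C)
qed

text \<open>A graph on \<open>V\<close> is represented by its edge set, a subset of \<open>vertex_pairs V\<close>.\<close>

definition vertex_pairs :: "'v set \<Rightarrow> 'v set set" where
  "vertex_pairs V = {e. e \<subseteq> V \<and> card e = 2}"

definition edgelighter_states :: "'v set \<Rightarrow> ('v \<times> 'v set set) set" where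
  "edgelighter_states V = V \<times> Pow (vertex_pairs V)"

definition edgelighter ::
  "'v set \<Rightarrow> real \<Rightarrow> real \<Rightarrow> 'v \<times> 'v set set \<Rightarrow> ('v \<times> 'v set set) pmf" where
  "edgelighter V q1 q2 = (\<lambda>(u, G).
     bind_pmf (pmf_of_set V) (\<lambda>v.
       if v = u then return_pmf (v, G)
       else if {u, v} \<in> G then
         map_pmf (\<lambda>switch. (v, if switch then G - {{u, v}} else G)) (bernoulli_pmf q1)
       else
         map_pmf (\<lambda>switch. (v, if switch then insert {u, v} G else G)) (bernoulli_pmf q2)))"

text \<open>The value is \<open>\<infinity>\<close> on trajectories that never traverse all pairs.\<close>

definition pair_cover_time :: "'v set \<Rightarrow> (nat \<Rightarrow> 'v \<times> 'v set set) \<Rightarrow> ennreal" where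
  "pair_cover_time V \<omega> =
     (INF t\<in>{t. \<forall>e\<in>vertex_pairs V. \<exists>l<t. e = {fst (\<omega> l), fst (\<omega> (Suc l))}}. of_nat t)"

text \<open>
  Maximal expected cover time when the initial graph is \<open>G\<close>; the maximum is over the
  initial position of the walker.
\<close>

definition max_expected_cover_time ::
  "'v set \<Rightarrow> real \<Rightarrow> real \<Rightarrow> 'v set set \<Rightarrow> ennreal" where
  "max_expected_cover_time V q1 q2 G =
     (MAX x\<in>V. \<integral>\<^sup>+\<omega>. pair_cover_time V \<omega> \<partial>markov_path (edgelighter V q1 q2) (x, G))"

definition edgelighter_mixing_time :: "'v set \<Rightarrow> real \<Rightarrow> real \<Rightarrow> nat" where
  "edgelighter_mixing_time V q1 q2 = mixing_time (edgelighter_states V) (edgelighter V q1 q2)"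

end

(*
  The positions of the walker are independent and uniform, and since q1 = 1 - q2 a traversal
  resamples its pair as a Bernoulli(q2) variable whatever its previous status. Hence the law of the
  chain is governed by the walker together with the set C of traversed pairs: given the walk, the
  pairs in C are independent Bernoulli(q2) and the others are as in the initial graph.

  Cover time, upper bound: each pair is traversed within any two given steps with conditional
  probability at least 2/n^2; apply the union bound. Lower bound: with k untraversed pairs, of which
  d contain the current position, the harmonic number H_k drops in one step by d/(nk) in
  expectation, and the expectation of this drop after a uniform move is at most 2/n^2.
  So n^2/2 * H_N - 1, where N is the number of pairs, bounds the expected cover time from below.

  Mixing time, upper bound: once all pairs are traversed, one more step makes the chain exactly
  stationary, so the distance to stationarity is at most the probability that some pair is
  untraversed one step earlier. Lower bound: start from the complete graph. For t up to
  n^2 log n / 64, Markov's inequality for H_N - H_k leaves at least a constant times n^(3/2) pairs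
  untraversed with high probability, an excess of edges beyond the fluctuations of order n of the
  stationary number of edges.
*)

theory Submission
  imports Defs "HOL-Real_Asymp.Real_Asymp"
begin

subsection \<open>Trajectories\<close>

primrec path_pmf :: "('s \<Rightarrow> 's pmf) \<Rightarrow> 's \<Rightarrow> nat \<Rightarrow> 's list pmf" where
  "path_pmf K x 0 = return_pmf [x]"
| "path_pmf K x (Suc t) = bind_pmf (path_pmf K x t) (\<lambda>l. map_pmf (\<lambda>y. y # l) (K (hd l)))"

text \<open>Trajectories are listed with the most recent state first.\<close>

primrec trail :: "(nat \<Rightarrow> 's) \<Rightarrow> nat \<Rightarrow> 's list" where
  "trail \<omega> 0 = [\<omega> 0]"
| "trail \<omega> (Suc t) = \<omega> (Suc t) # trail \<omega> t"

lemma hd_trail: "hd (trail \<omega> t) = \<omega> t"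
  by (cases t) auto

lemma trail_eq_iff: "trail \<omega> t = trail s t \<longleftrightarrow> (\<forall>i\<le>t. \<omega> i = s i)"
  by (induction t) (auto simp: le_Suc_eq)

lemma ex_trail: "length l = Suc t \<Longrightarrow> \<exists>s. l = trail s t"
proof (induction t arbitrary: l)
  case 0
  then show ?case by (auto simp: length_Suc_conv)
next
  case (Suc t)
  then obtain y l' where l: "l = y # l'" "length l' = Suc t" by (auto simp: length_Suc_conv)
  with Suc.IH obtain s where "l' = trail s t" by blast
  then have "l = trail (s(Suc t := y)) (Suc t)"
    using l by (simp add: trail_eq_iff)
  then show ?case by blast
qed

lemma pmf_bind_Cons:
  "pmf (bind_pmf p (\<lambda>l. map_pmf (\<lambda>y. y # l) (f l))) (y # l) = pmf p l * pmf (f l) y"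
proof -
  have "pmf (map_pmf (\<lambda>y. y # l') (f l')) (y # l) = indicator {l} l' * pmf (f l) y" for l'
  proof (cases "l' = l")
    case True
    then show ?thesis
      using pmf_map_inj'[of "\<lambda>y. y # l" "f l" y] by (simp add: inj_def)
  next
    case False
    then show ?thesis by (auto simp: pmf_eq_0_set_pmf)
  qed
  then show ?thesis
    by (simp add: pmf_bind measure_pmf_single)
qed

text \<open>The right-hand side is the cylinder probability of \<open>emeasure_markov_path\<close>,
  so events depending on finitely many times can be evaluated in the discrete law
  \<open>path_pmf\<close>.\<close>

lemma pmf_path_pmf:
  "pmf (path_pmf K x t) (trail s t) = (if s 0 = x then \<Prod>i<t. pmf (K (s i)) (s (Suc i)) else 0)"
  by (induction t) (auto simp: pmf_bind_Cons hd_trail)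

lemma length_path_pmf: "l \<in> set_pmf (path_pmf K x t) \<Longrightarrow> length l = Suc t"
  by (induction t arbitrary: l) auto

lemma finite_path_pmf:
  assumes "\<And>s. finite (set_pmf (K s))"
  shows "finite (set_pmf (path_pmf K x t))"
  using assms by (induction t) auto

text \<open>The event is a finite disjoint union of cylinders, one for each list in
  \<open>F\<close>. Lying in the support, each list has length \<open>Suc t\<close> and is therefore
  the \<open>trail\<close> of some sequence.\<close>

lemma emeasure_markov_path_trail:
  assumes "finite F" "F \<subseteq> set_pmf (path_pmf K x t)"
  shows "{\<omega>. trail \<omega> t \<in> F} \<in> sets (markov_path K x)"
    and "emeasure (markov_path K x) {\<omega>. trail \<omega> t \<in> F} = emeasure (path_pmf K x t) F"
proof -
  have comp: "(\<lambda>\<omega>. \<omega> i) \<in> markov_path K x \<rightarrow>\<^sub>M count_space UNIV" for i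
    using measurable_component_singleton[of i UNIV "\<lambda>_. count_space UNIV"]
    by (subst measurable_cong_sets[OF sets_markov_path refl]) auto
  have single: "{\<omega>. trail \<omega> t = l} \<in> sets (markov_path K x) \<and>
      emeasure (markov_path K x) {\<omega>. trail \<omega> t = l} = pmf (path_pmf K x t) l" if l_in: "l \<in> F" for l
  proof -
    obtain s where l: "l = trail s t"
      using ex_trail[of l t] length_path_pmf[of l K x t] assms(2) l_in by blast
    have "{\<omega>. trail \<omega> t = l} = (\<Inter>i\<in>{..t}. (\<lambda>\<omega>. \<omega> i) -` {s i} \<inter> space (markov_path K x))"
      by (auto simp: l trail_eq_iff space_markov_path)
    also have "\<dots> \<in> sets (markov_path K x)"
      by (intro sets.finite_INT measurable_sets[OF comp]) auto
    finally show ?thesis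
      using emeasure_markov_path[of K x t s]
      by (simp add: l trail_eq_iff pmf_path_pmf)
  qed
  have U: "{\<omega>. trail \<omega> t \<in> F} = (\<Union>l\<in>F. {\<omega>. trail \<omega> t = l})"
    by auto
  show "{\<omega>. trail \<omega> t \<in> F} \<in> sets (markov_path K x)"
    unfolding U using single assms(1) by (intro sets.finite_UN) auto
  have "emeasure (markov_path K x) {\<omega>. trail \<omega> t \<in> F} =
      (\<Sum>l\<in>F. emeasure (markov_path K x) {\<omega>. trail \<omega> t = l})"
    unfolding U using single assms(1)
    by (intro sum_emeasure[symmetric]) (auto simp: disjoint_family_on_def)
  also have "\<dots> = (\<Sum>l\<in>F. ennreal (pmf (path_pmf K x t) l))"
    using single by (intro sum.cong) auto
  also have "\<dots> = emeasure (path_pmf K x t) F"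
    using assms(1) by (simp add: emeasure_measure_pmf_finite)
  finally show "emeasure (markov_path K x) {\<omega>. trail \<omega> t \<in> F} = emeasure (path_pmf K x t) F" .
qed

lemma prob_space_markov_path: "prob_space (markov_path K x)"
proof -
  interpret Ionescu_Tulcea "path_kernel K x" "\<lambda>_. count_space UNIV"
    by (rule Ionescu_Tulcea_path_kernel)
  let ?M = "\<lambda>_::nat. count_space (UNIV :: 'a set)"
  \<comment> \<open>The whole space is the cylinder over the empty index set, so its mass is that of
    the empty marginal.\<close>
  have "emeasure (markov_path K x) (PF.emb UNIV {} (space (PiM {} ?M))) = emeasure (CI {}) (space (PiM {} ?M))"
    unfolding markov_path_def by (rule lim) auto
  also have "\<dots> = 1"
    using prob_space.emeasure_space_1[OF PF.prob_space_P[of "{}"]] by (simp add: PF.space_P)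
  also have "PF.emb UNIV {} (space (PiM {} ?M)) = space (markov_path K x)"
    by (simp add: space_markov_path prod_emb_def space_PiM restrict_def vimage_def)
  finally show ?thesis
    by (rule prob_spaceI)
qed

text \<open>
  For an uncountable state space the event \<open>trail \<omega> t \<in> B t\<close> need not be measurable.
  Intersecting with the finite support of the law of the trail changes it on a null set only.
\<close>

lemma nn_integral_markov_path_trail:
  assumes fin: "\<And>s. finite (set_pmf (K s))"
  shows "(\<integral>\<^sup>+\<omega>. (\<Sum>t. indicator (B t) (trail \<omega> t)) \<partial>markov_path K x) =
    (\<Sum>t. emeasure (path_pmf K x t) (B t))"
proof -
  interpret prob_space "markov_path K x" by (rule prob_space_markov_path)
  let ?S = "\<lambda>t. set_pmf (path_pmf K x t)"
  have S: "finite (?S t)" for t by (rule finite_path_pmf[OF fin])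
  have "emeasure (path_pmf K x t) (?S t) = 1" for t
    using emeasure_Int_set_pmf[of "path_pmf K x t" UNIV] measure_pmf.emeasure_space_1[of "path_pmf K x t"]
    by simp
  then have 1: "AE \<omega> in markov_path K x. trail \<omega> t \<in> ?S t" for t
    using emeasure_markov_path_trail[OF S subset_refl, of t]
    by (intro AE_I_eq_1) (auto simp: space_markov_path)
  then have "AE \<omega> in markov_path K x. \<forall>t. trail \<omega> t \<in> ?S t"
    by (subst AE_all_countable) auto
  then have "(\<integral>\<^sup>+\<omega>. (\<Sum>t. indicator (B t) (trail \<omega> t)) \<partial>markov_path K x) =
      (\<integral>\<^sup>+\<omega>. (\<Sum>t. indicator {\<omega>. trail \<omega> t \<in> B t \<inter> ?S t} \<omega>) \<partial>markov_path K x)"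
    by (intro nn_integral_cong_AE) (elim eventually_mono, auto simp: indicator_def)
  also have "\<dots> = (\<Sum>t. \<integral>\<^sup>+\<omega>. indicator {\<omega>. trail \<omega> t \<in> B t \<inter> ?S t} \<omega> \<partial>markov_path K x)"
    using emeasure_markov_path_trail(1)[of "B t \<inter> ?S t" K x t for t] S
    by (intro nn_integral_suminf borel_measurable_indicator) auto
  also have "\<dots> = (\<Sum>t. emeasure (path_pmf K x t) (B t))"
    using emeasure_markov_path_trail[of "B t \<inter> ?S t" K x t for t] S
    by (subst nn_integral_indicator) (auto simp: emeasure_Int_set_pmf)
  finally show ?thesis .
qed

text \<open>Pointwise tail-sum formula: a nonempty upward closed \<open>T\<close> is a half-line,
  and its least element counts the times outside \<open>T\<close>. For empty \<open>T\<close> both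
  sides are infinite.\<close>

lemma INF_of_nat_eq_suminf:
  assumes up: "\<And>s t. s \<in> T \<Longrightarrow> s \<le> t \<Longrightarrow> t \<in> T"
  shows "(INF t\<in>T. of_nat t :: ennreal) = (\<Sum>t. indicator (- T) t)"
proof (cases "T = {}")
  case True
  have "(\<Sum>t::nat. 1 :: ennreal) = top"
    by (simp add: suminf_eq_SUP ennreal_SUP_of_nat_eq_top)
  then show ?thesis using True by simp
next
  case False
  define m where "m = (LEAST t. t \<in> T)"
  have m: "m \<in> T" "\<And>t. t \<in> T \<Longrightarrow> m \<le> t"
    using False by (auto simp: m_def intro: LeastI Least_le)
  have T: "T = {m..}" using m up by auto
  have "(INF t\<in>T. of_nat t :: ennreal) = of_nat m"
    by (intro antisym INF_lower INF_greatest m) (use m in auto)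
  also have "\<dots> = (\<Sum>t<m. indicator (- T) t)"
    by (simp add: T indicator_def)
  also have "\<dots> = (\<Sum>t. indicator (- T) t)"
    by (intro suminf_finite[symmetric]) (auto simp: T)
  finally show ?thesis .
qed

subsection \<open>The walk together with the set of traversed pairs\<close>

text \<open>Staying put must leave \<open>C\<close> alone: \<open>{u, u}\<close> is a singleton, and
  \<open>C\<close> is to remain a set of pairs.\<close>

definition cover_step :: "'v \<Rightarrow> 'v \<Rightarrow> 'v set set \<Rightarrow> 'v set set" where
  "cover_step u v C = (if v = u then C else insert {u, v} C)"

definition walk_cover :: "'v set \<Rightarrow> 'v \<times> 'v set set \<Rightarrow> ('v \<times> 'v set set) pmf" where
  "walk_cover V = (\<lambda>(u, C). map_pmf (\<lambda>v. (v, cover_step u v C)) (pmf_of_set V))"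

definition uncovered_prob :: "'v set \<Rightarrow> 'v \<Rightarrow> nat \<Rightarrow> real" where
  "uncovered_prob V x t =
     measure_pmf.prob (kernel_power (walk_cover V) t (x, {})) {(u, C). \<not> vertex_pairs V \<subseteq> C}"

fun covered :: "('v \<times> 'g) list \<Rightarrow> 'v set set" where
  "covered (z # y # l) = cover_step (fst y) (fst z) (covered (y # l))"
| "covered _ = {}"

lemma covered_trail:
  "e \<in> covered (trail \<omega> t) \<longleftrightarrow>
    (\<exists>l<t. fst (\<omega> l) \<noteq> fst (\<omega> (Suc l)) \<and> e = {fst (\<omega> l), fst (\<omega> (Suc l))})"
proof (induction t)
  case (Suc t)
  have "covered (trail \<omega> (Suc t)) = cover_step (fst (\<omega> t)) (fst (\<omega> (Suc t))) (covered (trail \<omega> t))"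
    by (cases t) auto
  then show ?case
    using Suc by (auto simp: cover_step_def less_Suc_eq)
qed auto

text \<open>Whatever the switch does, the walker moves to the chosen vertex; graph and parameters do
  not influence the positions.\<close>

lemma map_fst_edgelighter:
  "map_pmf fst (edgelighter V q1 q2 s) = pmf_of_set V"
proof -
  obtain u G where s: "s = (u, G)" by force
  have "map_pmf fst (edgelighter V q1 q2 s) = bind_pmf (pmf_of_set V) return_pmf"
    unfolding s edgelighter_def prod.case map_bind_pmf
    by (intro bind_pmf_cong refl) (auto simp: pmf.map_comp o_def)
  then show ?thesis by (simp add: bind_return_pmf')
qed

text \<open>The next position is uniform whatever the history, so position and traversed pairs form
  a Markov chain by themselves, from which the graph has disappeared.\<close>

lemma map_covered_path_pmf:
  "map_pmf (\<lambda>l. (fst (hd l), covered l)) (path_pmf (edgelighter V q1 q2) (x, G) t) =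
    kernel_power (walk_cover V) t (x, {})"
proof (induction t)
  case (Suc t)
  let ?f = "\<lambda>l. (fst (hd l), covered l)"
  have "map_pmf ?f (path_pmf (edgelighter V q1 q2) (x, G) (Suc t)) =
    bind_pmf (path_pmf (edgelighter V q1 q2) (x, G) t) (\<lambda>l. walk_cover V (?f l))"
    unfolding path_pmf.simps map_bind_pmf
  proof (intro bind_pmf_cong refl)
    fix l assume "l \<in> set_pmf (path_pmf (edgelighter V q1 q2) (x, G) t)"
    then obtain y l' where l: "l = y # l'"
      using length_path_pmf by (cases l) force+
    show "map_pmf ?f (map_pmf (\<lambda>y. y # l) (edgelighter V q1 q2 (hd l))) = walk_cover V (?f l)"
      by (simp add: walk_cover_def map_fst_edgelighter[of V q1 q2 y, symmetric] pmf.map_comp o_def l)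
  qed
  also have "\<dots> = bind_pmf (map_pmf ?f (path_pmf (edgelighter V q1 q2) (x, G) t)) (walk_cover V)"
    by (simp add: bind_map_pmf)
  finally show ?case
    by (simp add: Suc)
qed simp

text \<open>Tail-sum formula: the summand at \<open>t\<close> is the probability that the cover time
  exceeds \<open>t\<close>. It depends neither on the initial graph nor on the parameters.\<close>

lemma expected_cover_time_eq:
  assumes V: "finite V" "V \<noteq> {}"
  shows "(\<integral>\<^sup>+\<omega>. pair_cover_time V \<omega> \<partial>markov_path (edgelighter V q1 q2) (x, G)) =
    (\<Sum>t. ennreal (uncovered_prob V x t))"
proof -
  have fin: "finite (set_pmf (edgelighter V q1 q2 s))" for s
    using V by (auto simp: edgelighter_def split: prod.split)
  let ?B = "{l. \<not> vertex_pairs V \<subseteq> covered l}"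
  have "pair_cover_time V \<omega> = (\<Sum>t. indicator ?B (trail \<omega> t))" for \<omega> :: "nat \<Rightarrow> 'a \<times> 'a set set"
  proof -
    let ?T = "{t. \<forall>e\<in>vertex_pairs V. \<exists>l<t. e = {fst (\<omega> l), fst (\<omega> (Suc l))}}"
    have T: "t \<in> ?T \<longleftrightarrow> vertex_pairs V \<subseteq> covered (trail \<omega> t)" for t
    proof -
      \<comment> \<open>A pair has two distinct ends, so the inequality in
        \<open>covered_trail\<close> is automatic.\<close>
      have "e \<in> covered (trail \<omega> t) \<longleftrightarrow> (\<exists>l<t. e = {fst (\<omega> l), fst (\<omega> (Suc l))})"
        if "e \<in> vertex_pairs V" for e
        using that by (auto simp: covered_trail vertex_pairs_def)
      then show ?thesis by blast
    qed
    have "pair_cover_time V \<omega> = (\<Sum>t. indicator (- ?T) t)"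
      unfolding pair_cover_time_def
      by (rule INF_of_nat_eq_suminf) (blast intro: less_le_trans)
    also have "\<dots> = (\<Sum>t. indicator ?B (trail \<omega> t))"
      using T by (auto simp: indicator_def intro!: suminf_cong)
    finally show ?thesis .
  qed
  then have "(\<integral>\<^sup>+\<omega>. pair_cover_time V \<omega> \<partial>markov_path (edgelighter V q1 q2) (x, G)) =
      (\<Sum>t. emeasure (path_pmf (edgelighter V q1 q2) (x, G) t) ?B)"
    using nn_integral_markov_path_trail[where K = "edgelighter V q1 q2" and x = "(x, G)" and B = "\<lambda>_. ?B"] fin by simp
  also have "\<dots> = (\<Sum>t. ennreal (uncovered_prob V x t))"
  proof (intro suminf_cong)
    fix t
    show "emeasure (path_pmf (edgelighter V q1 q2) (x, G) t) ?B = ennreal (uncovered_prob V x t)"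
      unfolding uncovered_prob_def map_covered_path_pmf[of V q1 q2 x G t, symmetric]
        measure_pmf.emeasure_eq_measure[symmetric] emeasure_map_pmf
      by (intro arg_cong2[of _ _ _ _ emeasure]) auto
  qed
  finally show ?thesis .
qed

lemma expectation_bind_finite:
  fixes h :: "'b \<Rightarrow> real"
  assumes "finite (set_pmf p)" "\<And>x. x \<in> set_pmf p \<Longrightarrow> finite (set_pmf (f x))"
  shows "measure_pmf.expectation (bind_pmf p f) h =
    measure_pmf.expectation p (\<lambda>x. measure_pmf.expectation (f x) h)"
  using pmf_expectation_bind[of "set_pmf p" f p h] assms
    integral_measure_pmf[of "set_pmf p" p "\<lambda>x. measure_pmf.expectation (f x) h"]
  by simp

lemma expectation_mono_finite:
  fixes f g :: "'a \<Rightarrow> real"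
  assumes "finite (set_pmf p)" "\<And>x. x \<in> set_pmf p \<Longrightarrow> f x \<le> g x"
  shows "measure_pmf.expectation p f \<le> measure_pmf.expectation p g"
  using assms by (intro integral_mono_AE integrable_measure_pmf_finite) (auto simp: AE_measure_pmf_iff)

lemma expectation_of_bool: "measure_pmf.expectation p (\<lambda>x. of_bool (P x)) = measure_pmf.prob p {x. P x}"
proof -
  have "(\<lambda>x. of_bool (P x) :: real) = indicator {x. P x}"
    by (auto simp: indicator_def)
  then show ?thesis by simp
qed

locale vertex_set =
  fixes V :: "'v set" and n :: nat
  assumes finite_V: "finite V" and card_V: "card V = n" and n_ge_2: "n \<ge> 2"
begin

abbreviation "pairs \<equiv> vertex_pairs V"

abbreviation "N \<equiv> card pairs"

abbreviation "cover_law x t \<equiv> kernel_power (walk_cover V) t (x, {})"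

definition unvisited_degree :: "'v \<Rightarrow> 'v set set \<Rightarrow> nat" where
  "unvisited_degree u C = card {e \<in> pairs - C. u \<in> e}"

lemma V_ne: "V \<noteq> {}"
  using card_V n_ge_2 by auto

lemma finite_pairs: "finite pairs"
  unfolding vertex_pairs_def using finite_V by auto

lemma pair_in_pairs: "u \<in> V \<Longrightarrow> v \<in> V \<Longrightarrow> {u, v} \<in> pairs \<longleftrightarrow> v \<noteq> u"
  by (auto simp: vertex_pairs_def card_2_iff doubleton_eq_iff)

lemma finite_walk_cover: "finite (set_pmf (walk_cover V s))"
  using finite_V V_ne by (auto simp: walk_cover_def split: prod.split)

lemma finite_cover_law: "finite (set_pmf (kernel_power (walk_cover V) t s))"
  using finite_walk_cover by (induction t) auto

lemma cover_law_support:
  assumes "x \<in> V" "(u, C) \<in> set_pmf (cover_law x t)"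
  shows "u \<in> V" "C \<subseteq> pairs"
proof -
  have "u \<in> V \<and> C \<subseteq> pairs"
    using assms(2)
  proof (induction t arbitrary: u C)
    case 0
    then show ?case using assms(1) by simp
  next
    case (Suc t)
    then obtain w D where wD: "(w, D) \<in> set_pmf (cover_law x t)" "(u, C) \<in> set_pmf (walk_cover V (w, D))"
      by auto
    then have "u \<in> V" "C = cover_step w u D"
      using finite_V V_ne by (auto simp: walk_cover_def)
    then show ?case
      using Suc.IH[OF wD(1)] pair_in_pairs[of w u] by (simp add: cover_step_def)
  qed
  then show "u \<in> V" "C \<subseteq> pairs" by auto
qed

lemma expectation_walk_cover:
  fixes f :: "_ \<Rightarrow> real"
  shows "measure_pmf.expectation (walk_cover V (u, C)) f = (\<Sum>v\<in>V. f (v, cover_step u v C)) / n"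
  using finite_V V_ne by (simp add: walk_cover_def integral_pmf_of_set card_V)

lemma expectation_cover_law_Suc:
  fixes f :: "_ \<Rightarrow> real"
  shows "measure_pmf.expectation (kernel_power (walk_cover V) (Suc t) s) f =
    measure_pmf.expectation (kernel_power (walk_cover V) t s)
      (\<lambda>s. measure_pmf.expectation (walk_cover V s) f)"
  using finite_cover_law finite_walk_cover by (simp add: expectation_bind_finite)

subsection \<open>Upper bound on the probability of an untraversed pair\<close>

text \<open>Whatever the current state, the next two positions are the ends of \<open>e\<close> with probability \<open>2/n\<^sup>2\<close>.\<close>

lemma two_step_miss:
  assumes "u \<in> V" "e \<in> pairs"
  shows "measure_pmf.expectation (walk_cover V (u, C))
      (\<lambda>s. measure_pmf.expectation (walk_cover V s) (\<lambda>(u, C). of_bool (e \<notin> C)))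
    \<le> of_bool (e \<notin> C) * (1 - 2 / real n ^ 2)"
proof -
  from assms(2) obtain a b where e: "e = {a, b}" "a \<noteq> b" "a \<in> V" "b \<in> V"
    by (auto simp: vertex_pairs_def card_2_iff)
  have one: "(\<Sum>v\<in>V. \<Sum>w\<in>V. of_bool (v = c) * of_bool (w = d)) = (1 :: real)" if "c \<in> V" "d \<in> V" for c d
  proof -
    have "(\<Sum>w\<in>V. of_bool (w = c)) = (1 :: real)" if "c \<in> V" for c
      using that finite_V by (simp add: of_bool_def)
    then show ?thesis
      using that by (simp flip: sum_distrib_left sum_distrib_right del: sum_of_bool_eq sum_of_bool_mult_eq)
  qed
  let ?g = "\<lambda>v w. of_bool (e \<notin> cover_step v w (cover_step u v C)) :: real"
  \<comment> \<open>If the next two positions are a, b or b, a, the second step traverses e. In all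
    other cases only the growth of the traversed set is used. As a and b differ, the two cases
    exclude each other.\<close>
  have "?g v w \<le> of_bool (e \<notin> C) * (1 - of_bool (v = a) * of_bool (w = b) - of_bool (v = b) * of_bool (w = a))"
    for v w
  proof (cases "v = a \<and> w = b \<or> v = b \<and> w = a")
    case True
    then have "e \<in> cover_step v w (cover_step u v C)"
      using e by (auto simp: cover_step_def)
    then show ?thesis using True e(2) by auto
  next
    case False
    then have "of_bool (v = a) * of_bool (w = b) = (0::real)" "of_bool (v = b) * of_bool (w = a) = (0::real)"
      by auto
    moreover have "e \<in> C \<Longrightarrow> e \<in> cover_step v w (cover_step u v C)"
      by (auto simp: cover_step_def)
    ultimately show ?thesis by auto
  qed
  then have "(\<Sum>v\<in>V. \<Sum>w\<in>V. ?g v w) \<le> (\<Sum>v\<in>V. \<Sum>w\<in>V. of_bool (e \<notin> C) *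
      (1 - of_bool (v = a) * of_bool (w = b) - of_bool (v = b) * of_bool (w = a)))"
    by (intro sum_mono)
  also have "\<dots> = of_bool (e \<notin> C) * (real n * real n - 2)"
    using one[of a b] one[of b a] e
    by (simp add: sum_distrib_left[symmetric] sum_subtractf card_V del: sum_of_bool_mult_eq)
  finally have "(\<Sum>v\<in>V. \<Sum>w\<in>V. ?g v w) / n / n \<le> of_bool (e \<notin> C) * (real n * real n - 2) / n / n"
    by (intro divide_right_mono) auto
  also have "\<dots> = of_bool (e \<notin> C) * (1 - 2 / real n ^ 2)"
    using n_ge_2 by (simp add: field_simps power2_eq_square)
  finally show ?thesis
    by (simp add: expectation_walk_cover sum_divide_distrib)
qed

lemma four_le_n_sq: "4 \<le> real n ^ 2"
  using n_ge_2 power_mono[of 2 "real n" 2] by simp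

lemma miss_prob_nonneg: "0 \<le> 1 - 2 / real n ^ 2"
  using four_le_n_sq n_ge_2 by (simp add: divide_le_eq)

text \<open>Condition on the state at the start of each of \<open>k\<close> disjoint blocks of two
  steps and apply \<open>two_step_miss\<close>.\<close>

lemma prob_pair_uncovered:
  assumes "x \<in> V" "e \<in> pairs"
  shows "measure_pmf.prob (cover_law x (2 * k)) {(u, C). e \<notin> C} \<le> (1 - 2 / real n ^ 2) ^ k"
proof (induction k)
  case (Suc k)
  let ?f = "\<lambda>(u, C). of_bool (e \<notin> C) :: real"
  have prob: "measure_pmf.prob (cover_law x t) {(u, C). e \<notin> C} = measure_pmf.expectation (cover_law x t) ?f" for t
    using expectation_of_bool[of "cover_law x t" "\<lambda>(u, C). e \<notin> C"] by (simp add: case_prod_unfold)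
  have "measure_pmf.expectation (cover_law x (Suc (Suc (2 * k)))) ?f \<le>
    measure_pmf.expectation (cover_law x (2 * k)) (\<lambda>s. ?f s * (1 - 2 / real n ^ 2))"
    unfolding expectation_cover_law_Suc
  proof (intro expectation_mono_finite finite_cover_law)
    fix s assume "s \<in> set_pmf (cover_law x (2 * k))"
    then show "measure_pmf.expectation (walk_cover V s) (\<lambda>s. measure_pmf.expectation (walk_cover V s) ?f)
        \<le> ?f s * (1 - 2 / real n ^ 2)"
      using two_step_miss[OF _ assms(2)] cover_law_support(1)[OF assms(1)] by (cases s) auto
  qed
  also have "\<dots> = measure_pmf.prob (cover_law x (2 * k)) {(u, C). e \<notin> C} * (1 - 2 / real n ^ 2)"
    by (simp add: prob)
  also have "\<dots> \<le> (1 - 2 / real n ^ 2) ^ k * (1 - 2 / real n ^ 2)"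
    by (intro mult_right_mono Suc.IH miss_prob_nonneg)
  finally show ?case
    using prob[of "Suc (Suc (2 * k))"] by (simp add: mult.commute)
qed simp

lemma uncovered_prob_le_1: "uncovered_prob V x t \<le> 1"
  by (simp add: uncovered_prob_def)

lemma uncovered_prob_nonneg: "0 \<le> uncovered_prob V x t"
  by (simp add: uncovered_prob_def)

lemma uncovered_prob_eq_expectation:
  "uncovered_prob V x t = measure_pmf.expectation (cover_law x t) (\<lambda>(u, C). of_bool (\<not> pairs \<subseteq> C))"
  using expectation_of_bool[of "cover_law x t" "\<lambda>(u, C). \<not> pairs \<subseteq> C"]
  by (simp add: case_prod_unfold uncovered_prob_def)

lemma uncovered_prob_Suc_le: "uncovered_prob V x (Suc t) \<le> uncovered_prob V x t"
  unfolding uncovered_prob_eq_expectation expectation_cover_law_Suc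
proof (intro expectation_mono_finite finite_cover_law)
  fix s :: "'v \<times> 'v set set"
  let ?f = "\<lambda>(u, C). of_bool (\<not> pairs \<subseteq> C) :: real"
  obtain u C where s: "s = (u, C)" by force
  have "measure_pmf.expectation (walk_cover V s) ?f = (\<Sum>v\<in>V. ?f (v, cover_step u v C)) / n"
    by (simp add: s expectation_walk_cover)
  also have "\<dots> \<le> (\<Sum>v\<in>V. ?f s) / n"
    by (intro divide_right_mono sum_mono) (auto simp: s cover_step_def)
  also have "\<dots> = ?f s"
    using card_V n_ge_2 by (simp add: s)
  finally show "measure_pmf.expectation (walk_cover V s) ?f \<le> ?f s" .
qed

lemma uncovered_prob_bound:
  assumes "x \<in> V"
  shows "uncovered_prob V x (2 * k) \<le> N * (1 - 2 / real n ^ 2) ^ k"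
proof -
  have "uncovered_prob V x (2 * k) = measure_pmf.prob (cover_law x (2 * k)) (\<Union>e\<in>pairs. {(u, C). e \<notin> C})"
    unfolding uncovered_prob_def by (intro arg_cong2[of _ _ _ _ measure_pmf.prob]) auto
  also have "\<dots> \<le> (\<Sum>e\<in>pairs. measure_pmf.prob (cover_law x (2 * k)) {(u, C). e \<notin> C})"
    using finite_pairs by (intro measure_pmf.finite_measure_subadditive_finite) auto
  also have "\<dots> \<le> (\<Sum>e\<in>pairs. (1 - 2 / real n ^ 2) ^ k)"
    by (intro sum_mono prob_pair_uncovered assms)
  finally show ?thesis by simp
qed

subsection \<open>The harmonic potential\<close>

text \<open>Handshake count: each untraversed pair has two ends in \<open>V\<close>.\<close>

lemma sum_unvisited_degree: "(\<Sum>u\<in>V. unvisited_degree u C) = 2 * card (pairs - C)"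
proof -
  have "(\<Sum>u\<in>V. unvisited_degree u C) = (\<Sum>e\<in>pairs - C. card {u \<in> V. u \<in> e})"
    unfolding unvisited_degree_def
    using sum_multicount_gen[of V "pairs - C" "\<lambda>u e. u \<in> e" "\<lambda>e. card {u \<in> V. u \<in> e}"] finite_V finite_pairs
    by auto
  also have "\<dots> = (\<Sum>e\<in>pairs - C. 2)"
  proof (intro sum.cong refl)
    fix e assume "e \<in> pairs - C"
    moreover from this have "{u \<in> V. u \<in> e} = e" by (auto simp: vertex_pairs_def)
    ultimately show "card {u \<in> V. u \<in> e} = 2" by (simp add: vertex_pairs_def)
  qed
  finally show ?thesis by simp
qed

text \<open>The left side counts the moves out of \<open>u\<close> that traverse a new pair; sending
  v to \<open>{u, v}\<close> matches them with the untraversed pairs at \<open>u\<close>.\<close>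

lemma unvisited_degree_eq:
  assumes "u \<in> V"
  shows "card {v \<in> V. v \<noteq> u \<and> {u, v} \<notin> C} = unvisited_degree u C"
  unfolding unvisited_degree_def
proof (intro bij_betw_same_card[where f = "\<lambda>v. {u, v}"] bij_betw_imageI)
  show "inj_on (\<lambda>v. {u, v}) {v \<in> V. v \<noteq> u \<and> {u, v} \<notin> C}"
    by (auto simp: inj_on_def doubleton_eq_iff)
  have "e \<in> (\<lambda>v. {u, v}) ` {v \<in> V. v \<noteq> u \<and> {u, v} \<notin> C}" if e: "e \<in> pairs - C" "u \<in> e" for e
  proof -
    obtain v where "e = {u, v}" "v \<noteq> u"
      using e by (auto simp: vertex_pairs_def card_2_iff)
    moreover have "v \<in> V" using calculation e by (auto simp: vertex_pairs_def)
    ultimately show ?thesis using e by auto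
  qed
  then show "(\<lambda>v. {u, v}) ` {v \<in> V. v \<noteq> u \<and> {u, v} \<notin> C} = {e \<in> pairs - C. u \<in> e}"
    using assms by (auto simp: pair_in_pairs)
qed

lemma unvisited_degree_empty:
  assumes "u \<in> V"
  shows "unvisited_degree u {} = n - 1"
proof -
  have "{v \<in> V. v \<noteq> u} = V - {u}" by auto
  then show ?thesis
    using unvisited_degree_eq[OF assms, of "{}"] assms card_V finite_V by (simp add: card_Diff_singleton)
qed

lemma card_pairs: "2 * N = n * (n - 1)"
  using sum_unvisited_degree[of "{}"] by (simp add: unvisited_degree_empty card_V)

lemma N_pos: "N > 0"
  using card_pairs n_ge_2 by (cases "N = 0") auto

text \<open>Harmonic numbers are chosen because the drop 1/k from k to k - 1 cancels the total
  degree 2k of the untraversed pairs, giving a drift bound free of k.\<close>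

definition potential :: "'v \<times> 'v set set \<Rightarrow> real" where
  "potential = (\<lambda>(u, C). harm (card (pairs - C)))"

text \<open>When all pairs are traversed, division by zero gives the intended value \<open>0\<close>.\<close>

definition drift :: "'v \<times> 'v set set \<Rightarrow> real" where
  "drift = (\<lambda>(u, C). real (unvisited_degree u C) / (n * card (pairs - C)))"

lemma card_pairs_minus_cover_step:
  assumes "u \<in> V" "v \<in> V"
  shows "card (pairs - cover_step u v C) = card (pairs - C) - of_bool (v \<noteq> u \<and> {u, v} \<notin> C)"
proof (cases "v \<noteq> u \<and> {u, v} \<notin> C")
  case True
  then have "pairs - cover_step u v C = (pairs - C) - {{u, v}}"
    by (auto simp: cover_step_def)
  then show ?thesis
    using True pair_in_pairs[OF assms] finite_pairs by (simp add: card_Diff_singleton)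
next
  case False
  then have "pairs - cover_step u v C = pairs - C" by (auto simp: cover_step_def)
  then show ?thesis using False by auto
qed

lemma expectation_potential:
  assumes "u \<in> V"
  shows "measure_pmf.expectation (walk_cover V (u, C)) potential = potential (u, C) - drift (u, C)"
proof -
  let ?k = "card (pairs - C)"
  have pot: "potential (v, cover_step u v C) = harm ?k - of_bool (v \<noteq> u \<and> {u, v} \<notin> C) / ?k"
    if v: "v \<in> V" for v
  proof (cases "v \<noteq> u \<and> {u, v} \<notin> C")
    case True
    then have "{u, v} \<in> pairs - C" using pair_in_pairs[OF assms v] by auto
    then have "?k > 0" using finite_pairs by (auto simp: card_gt_0_iff)
    then obtain j where "?k = Suc j" by (cases ?k) auto
    then show ?thesis
      using True card_pairs_minus_cover_step[OF assms v, of C]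
      by (simp add: potential_def harm_Suc inverse_eq_divide)
  next
    case False
    then show ?thesis using card_pairs_minus_cover_step[OF assms v, of C] by (auto simp: potential_def)
  qed
  have "(\<Sum>v\<in>V. of_bool (v \<noteq> u \<and> {u, v} \<notin> C) :: real) = unvisited_degree u C"
    using finite_V by (simp add: unvisited_degree_eq[OF assms, symmetric] Int_def)
  then have "(\<Sum>v\<in>V. potential (v, cover_step u v C)) = n * harm ?k - unvisited_degree u C / ?k"
    by (simp add: pot sum_subtractf sum_divide_distrib[symmetric] card_V del: sum_of_bool_eq)
  then show ?thesis
    using n_ge_2 by (simp add: expectation_walk_cover potential_def drift_def diff_divide_distrib mult.commute)
qed

text \<open>Traversing \<open>{u, v}\<close> replaces d/k at the new position v by (d - 1)/(k - 1),
  which is no larger because d is at most k. With \<open>C\<close> thus frozen, the degrees over the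
  uniform v sum to 2k.\<close>

lemma expectation_drift:
  assumes "u \<in> V"
  shows "measure_pmf.expectation (walk_cover V (u, C)) drift \<le> 2 / real n ^ 2 * of_bool (\<not> pairs \<subseteq> C)"
proof -
  let ?k = "card (pairs - C)"
  have le: "drift (v, cover_step u v C) \<le> drift (v, C)" if v: "v \<in> V" for v
  proof (cases "v \<noteq> u \<and> {u, v} \<notin> C")
    case True
    then have uv: "{u, v} \<in> pairs - C" using pair_in_pairs[OF assms v] by auto
    have k': "card (pairs - cover_step u v C) = ?k - 1"
      using True card_pairs_minus_cover_step[OF assms v, of C] by simp
    have "{e \<in> pairs - cover_step u v C. v \<in> e} = {e \<in> pairs - C. v \<in> e} - {{u, v}}"
      using True by (auto simp: cover_step_def)
    then have d': "unvisited_degree v (cover_step u v C) = unvisited_degree v C - 1"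
      using uv finite_pairs by (simp add: unvisited_degree_def card_Diff_singleton)
    have "0 < unvisited_degree v C"
      using uv finite_pairs by (auto simp: unvisited_degree_def card_gt_0_iff)
    moreover have "unvisited_degree v C \<le> ?k"
      unfolding unvisited_degree_def using finite_pairs by (intro card_mono) auto
    ultimately obtain d k where dk: "unvisited_degree v C = Suc d" "?k = Suc k" "d \<le> k"
      by (cases "unvisited_degree v C"; cases ?k) auto
    \<comment> \<open>Here d and k are already lowered by one; for k = 0 the last pair has been
      traversed and the left side is 0 by division by zero.\<close>
    have "real d / k \<le> real (Suc d) / Suc k"
      using dk by (cases "k = 0") (auto simp: field_simps)
    then have "real d / k / n \<le> real (Suc d) / Suc k / n"
      by (intro divide_right_mono) auto
    then show ?thesis
      using k' d' dk by (simp add: drift_def mult.commute)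
  next
    case False
    then have eq: "pairs - cover_step u v C = pairs - C" by (auto simp: cover_step_def)
    show ?thesis by (simp only: drift_def unvisited_degree_def eq prod.case order_refl)
  qed
  have "(\<Sum>v\<in>V. drift (v, cover_step u v C)) \<le> (\<Sum>v\<in>V. drift (v, C))"
    by (intro sum_mono le)
  also have "\<dots> = real (\<Sum>v\<in>V. unvisited_degree v C) / (n * ?k)"
    by (simp add: drift_def sum_divide_distrib)
  also have "\<dots> = 2 / n * of_bool (\<not> pairs \<subseteq> C)"
    using finite_pairs n_ge_2 unfolding sum_unvisited_degree by (auto simp: field_simps)
  finally have "(\<Sum>v\<in>V. drift (v, cover_step u v C)) / n \<le> 2 / n * of_bool (\<not> pairs \<subseteq> C) / n"
    by (intro divide_right_mono) auto
  then show ?thesis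
    by (simp add: expectation_walk_cover power2_eq_square mult.commute)
qed

text \<open>\<open>expectation_drift\<close> bounds the drift at each time s + 1 by the situation at
  time s. At time 0 no uniform move has occurred, and the exact drift (n - 1)/(nN) = 2/n^2 produces
  the summand 1.\<close>

lemma expected_drift_le:
  assumes "x \<in> V"
  shows "(\<Sum>s<t. measure_pmf.expectation (cover_law x s) drift) \<le> 2 / real n ^ 2 * (1 + (\<Sum>s<t. uncovered_prob V x s))"
proof -
  have step: "measure_pmf.expectation (cover_law x (Suc s)) drift \<le> 2 / real n ^ 2 * uncovered_prob V x s" for s
  proof -
    have "measure_pmf.expectation (cover_law x (Suc s)) drift \<le>
      measure_pmf.expectation (cover_law x s) (\<lambda>z. 2 / real n ^ 2 * (case z of (u, C) \<Rightarrow> of_bool (\<not> pairs \<subseteq> C)))"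
      unfolding expectation_cover_law_Suc
    proof (intro expectation_mono_finite finite_cover_law)
      fix z assume "z \<in> set_pmf (cover_law x s)"
      then show "measure_pmf.expectation (walk_cover V z) drift \<le> 2 / real n ^ 2 * (case z of (u, C) \<Rightarrow> of_bool (\<not> pairs \<subseteq> C))"
        using expectation_drift cover_law_support(1)[OF assms] by (cases z) auto
    qed
    then show ?thesis by (simp add: uncovered_prob_eq_expectation)
  qed
  have zero: "measure_pmf.expectation (cover_law x 0) drift = 2 / real n ^ 2"
  proof -
    have "real n * (real n - 1) = 2 * N"
      using arg_cong[OF card_pairs, of real] n_ge_2 by (simp add: of_nat_diff)
    then show ?thesis
      using n_ge_2 N_pos assms
      by (simp add: drift_def unvisited_degree_empty of_nat_diff field_simps power2_eq_square)
  qed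
  show ?thesis
  proof (cases t)
    case (Suc t')
    have "(\<Sum>s<t. measure_pmf.expectation (cover_law x s) drift) =
      2 / real n ^ 2 + (\<Sum>s<t'. measure_pmf.expectation (cover_law x (Suc s)) drift)"
      unfolding Suc sum.lessThan_Suc_shift zero by simp
    also have "\<dots> \<le> 2 / real n ^ 2 + (\<Sum>s<t'. 2 / real n ^ 2 * uncovered_prob V x s)"
      by (intro add_left_mono sum_mono step)
    also have "\<dots> \<le> 2 / real n ^ 2 + 2 / real n ^ 2 * (\<Sum>s<t. uncovered_prob V x s)"
      unfolding sum_distrib_left[symmetric]
      by (intro add_left_mono mult_left_mono) (simp_all add: Suc uncovered_prob_nonneg)
    finally show ?thesis by (simp add: distrib_left)
  qed simp
qed

text \<open>The drift is the exact expected loss in one step, so the expected potential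
  telescopes.\<close>

lemma expected_potential_ge:
  assumes "x \<in> V"
  shows "measure_pmf.expectation (cover_law x t) potential \<ge>
    harm N - 2 / real n ^ 2 * (1 + (\<Sum>s<t. uncovered_prob V x s))"
proof -
  have "measure_pmf.expectation (cover_law x t) potential =
      harm N - (\<Sum>s<t. measure_pmf.expectation (cover_law x s) drift)"
  proof (induction t)
    case 0
    then show ?case by (simp add: potential_def)
  next
    case (Suc t)
    have "measure_pmf.expectation (cover_law x (Suc t)) potential =
        measure_pmf.expectation (cover_law x t) (\<lambda>z. potential z - drift z)"
      unfolding expectation_cover_law_Suc
      using cover_law_support(1)[OF assms] expectation_potential
      by (intro integral_cong_AE) (auto simp: AE_measure_pmf_iff)
    also have "\<dots> = measure_pmf.expectation (cover_law x t) potential - measure_pmf.expectation (cover_law x t) drift"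
      by (intro Bochner_Integration.integral_diff integrable_measure_pmf_finite finite_cover_law)
    finally show ?case using Suc by simp
  qed
  then show ?thesis using expected_drift_le[OF assms, of t] by simp
qed

text \<open>The potential vanishes once all pairs are traversed and never exceeds
  \<open>harm N\<close>.\<close>

lemma expected_potential_le:
  "measure_pmf.expectation (cover_law x t) potential \<le> harm N * uncovered_prob V x t"
proof -
  have "measure_pmf.expectation (cover_law x t) potential \<le>
    measure_pmf.expectation (cover_law x t) (\<lambda>z. harm N * (case z of (u, C) \<Rightarrow> of_bool (\<not> pairs \<subseteq> C)))"
  proof (intro expectation_mono_finite finite_cover_law)
    fix z :: "'v \<times> 'v set set"
    obtain u C where z: "z = (u, C)" by force
    have "card (pairs - C) \<le> N" by (intro card_mono finite_pairs) auto
    then have "harm (card (pairs - C)) \<le> (harm N :: real)" by (rule harm_mono)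
    then show "potential z \<le> harm N * (case z of (u, C) \<Rightarrow> of_bool (\<not> pairs \<subseteq> C))"
    proof (cases "pairs \<subseteq> C")
      case True
      then have "pairs - C = {}" by auto
      then have "potential z = 0" by (simp only: z potential_def prod.case card.empty harm_expand)
      then show ?thesis using True by (simp add: z)
    qed (simp add: z potential_def)
  qed
  then show ?thesis by (simp add: uncovered_prob_eq_expectation)
qed

text \<open>Compare the two bounds on the expected potential at time \<open>t\<close> and solve for
  the sum, which is the expectation of the cover time truncated at \<open>t\<close>.\<close>

lemma sum_uncovered_prob_ge:
  assumes "x \<in> V"
  shows "real n ^ 2 / 2 * harm N * (1 - uncovered_prob V x t) - 1 \<le> (\<Sum>s<t. uncovered_prob V x s)"
proof -
  let ?S = "1 + (\<Sum>s<t. uncovered_prob V x s)"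
  have "harm N - 2 / real n ^ 2 * ?S \<le> harm N * uncovered_prob V x t"
    using expected_potential_ge[OF assms, of t] expected_potential_le[of t x] by linarith
  then have "harm N * (1 - uncovered_prob V x t) \<le> 2 / real n ^ 2 * ?S"
    by (simp add: algebra_simps)
  then have "real n ^ 2 / 2 * (harm N * (1 - uncovered_prob V x t)) \<le> real n ^ 2 / 2 * (2 / real n ^ 2 * ?S)"
    by (intro mult_left_mono) auto
  also have "\<dots> = ?S"
    using n_ge_2 by simp
  finally show ?thesis by (simp add: mult.assoc)
qed

subsection \<open>Bounds on the expected cover time\<close>

lemma N_le: "real N \<le> real n ^ 2 / 2"
  using arg_cong[OF card_pairs, of real] n_ge_2 by (simp add: of_nat_diff power2_eq_square algebra_simps)

lemma N_ge: "real n ^ 2 / 4 \<le> real N"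
proof -
  have "real n * 2 \<le> real n * real n"
    using n_ge_2 by (intro mult_left_mono) auto
  moreover have "2 * real N = real n * real n - real n"
    using arg_cong[OF card_pairs, of real] n_ge_2 by (simp add: of_nat_diff algebra_simps)
  ultimately show ?thesis by (simp add: power2_eq_square)
qed

lemma harm_N_ge: "2 * ln n - ln 4 \<le> harm N"
proof -
  have "2 * ln n - ln 4 = ln (real n ^ 2 / 4)"
    using n_ge_2 by (simp add: ln_div ln_realpow)
  also have "\<dots> \<le> ln (real N + 1)"
    using N_ge n_ge_2 by (intro ln_mono) auto
  also have "\<dots> \<le> harm N"
    by (rule harm_ge_ln)
  finally show ?thesis .
qed

text \<open>By 1 - y \<le> exp (- y), after c n^2 ln n blocks of two steps the union bound is at
  most n^(2 - 2c)/2. The cases c = 1 and c = 2 are used below.\<close>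

lemma miss_power_le:
  assumes "c * (real n ^ 2 * ln n) \<le> real k"
  shows "N * (1 - 2 / real n ^ 2) ^ k \<le> real n ^ 2 / 2 * exp (- 2 * c * ln n)"
proof -
  have "(1 - 2 / real n ^ 2) ^ k \<le> exp (- (2 / real n ^ 2)) ^ k"
    using exp_ge_add_one_self[of "- (2 / real n ^ 2)"] miss_prob_nonneg by (intro power_mono) auto
  also have "\<dots> = exp (- 2 * (k / real n ^ 2))"
    by (simp flip: exp_of_nat_mult)
  also have "\<dots> \<le> exp (- 2 * (c * ln n))"
    using assms n_ge_2 by (simp add: field_simps)
  finally have "(1 - 2 / real n ^ 2) ^ k \<le> exp (- 2 * c * ln n)"
    by (simp add: mult.assoc)
  then show ?thesis
    using N_le miss_prob_nonneg by (intro mult_mono) auto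
qed

text \<open>The factor 1 keeps the left side in the shape of \<open>miss_power_le\<close> at c =
  1.\<close>

lemma exp_minus_2_ln: "exp (- 2 * 1 * ln (real n)) = 1 / real n ^ 2"
  using n_ge_2 by (simp add: exp_minus exp_double inverse_eq_divide)

text \<open>By monotonicity odd times cost no more than the even times before them. The first
  \<open>k\<close> even times are bounded by 1 each, the later ones by a geometric series with sum
  at most n^2/2.\<close>

lemma sum_uncovered_prob_le:
  assumes "x \<in> V"
  shows "(\<Sum>t<T. uncovered_prob V x t) \<le> 2 * real k + real n ^ 2 * (N * (1 - 2 / real n ^ 2) ^ k)"
proof -
  let ?p = "uncovered_prob V x" and ?r = "1 - 2 / real n ^ 2"
  have pairing: "(\<Sum>t<2 * m. ?p t) \<le> 2 * (\<Sum>j<m. ?p (2 * j))" for m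
  proof (induction m)
    case (Suc m)
    then show ?case using uncovered_prob_Suc_le[of x "2 * m"] by simp
  qed simp
  have tail: "(\<Sum>j<k + m. ?p (2 * j)) \<le> k + (\<Sum>i<m. N * ?r ^ (k + i))" for m
  proof (induction m)
    case 0
    show ?case
      using sum_bounded_above[of "{..<k}" "\<lambda>j. ?p (2 * j)" 1] uncovered_prob_le_1[of x] by simp
  next
    case (Suc m)
    then show ?case
      using uncovered_prob_bound[OF assms, of "k + m"] by simp
  qed
  have geo: "(\<Sum>i<m. ?r ^ i) \<le> real n ^ 2 / 2" for m
  proof -
    have "(\<Sum>i<m. ?r ^ i) * (1 - ?r) = 1 - ?r ^ m"
      using one_diff_power_eq[of ?r m] by (simp add: mult.commute)
    also have "\<dots> \<le> 1"
      using miss_prob_nonneg by simp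
    finally show ?thesis
      using n_ge_2 by (simp add: field_simps)
  qed
  have "(\<Sum>t<T. ?p t) \<le> (\<Sum>t<2 * (k + T). ?p t)"
    by (intro sum_mono2) (auto simp: uncovered_prob_nonneg)
  also have "\<dots> \<le> 2 * (k + (\<Sum>i<T. N * ?r ^ (k + i)))"
    using pairing[of "k + T"] tail[of T] by simp
  also have "(\<Sum>i<T. N * ?r ^ (k + i)) = N * ?r ^ k * (\<Sum>i<T. ?r ^ i)"
    by (simp add: power_add sum_distrib_left mult.assoc)
  also have "2 * (k + N * ?r ^ k * (\<Sum>i<T. ?r ^ i)) \<le> 2 * (k + N * ?r ^ k * (real n ^ 2 / 2))"
    using geo miss_prob_nonneg by (intro mult_left_mono add_left_mono) auto
  also have "\<dots> = 2 * real k + real n ^ 2 * (N * ?r ^ k)"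
    by simp
  finally show ?thesis .
qed

lemma expected_cover_time_le:
  assumes "x \<in> V"
  shows "(\<integral>\<^sup>+\<omega>. pair_cover_time V \<omega> \<partial>markov_path (edgelighter V q1 q2) (x, G)) \<le>
    ennreal (2 * (real n ^ 2 * ln n + 1) + real n ^ 2 / 2)"
proof -
  \<comment> \<open>With this many blocks the union bound is at most 1/2, so the geometric tail
    contributes only n^2/2 and the leading term is 2 n^2 ln n.\<close>
  define k where "k = nat \<lceil>real n ^ 2 * ln n\<rceil>"
  have "0 \<le> real n ^ 2 * ln n" using n_ge_2 by simp
  then have k: "real n ^ 2 * ln n \<le> k" "k \<le> real n ^ 2 * ln n + 1"
    unfolding k_def by linarith+
  have miss: "real n ^ 2 * (N * (1 - 2 / real n ^ 2) ^ k) \<le> real n ^ 2 * (1 / 2)"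
    using miss_power_le[of 1 k] k(1) n_ge_2 unfolding exp_minus_2_ln
    by (intro mult_left_mono) auto
  have "(\<Sum>t<T. uncovered_prob V x t) \<le> 2 * (real n ^ 2 * ln n + 1) + real n ^ 2 / 2" for T
    using sum_uncovered_prob_le[OF assms, of T k] miss k by simp
  then show ?thesis
    unfolding expected_cover_time_eq[OF finite_V V_ne] suminf_eq_SUP
    by (intro SUP_least) (simp add: uncovered_prob_nonneg ennreal_leI)
qed

text \<open>The union bound at c = 2 is 1/(2 n^2), and n is at least 2. The value 1/8 yields the
  factor 7/8 in the lower bound on the cover time and a distance below 1/4 in the mixing
  bound.\<close>

lemma uncovered_prob_eighth:
  assumes "x \<in> V" "2 * (real n ^ 2 * ln n) \<le> k"
  shows "uncovered_prob V x (2 * k) \<le> 1 / 8"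
proof -
  have "exp (- 2 * 2 * ln n) = exp (- 2 * 1 * ln n) * exp (- 2 * 1 * ln n)"
    by (simp flip: exp_add)
  also have "\<dots> = 1 / (real n ^ 2 * real n ^ 2)"
    unfolding exp_minus_2_ln by simp
  finally have "uncovered_prob V x (2 * k) \<le> real n ^ 2 / 2 * (1 / (real n ^ 2 * real n ^ 2))"
    using uncovered_prob_bound[OF assms(1), of k] miss_power_le[OF assms(2)] by simp
  also have "\<dots> = 1 / (2 * real n ^ 2)"
    using n_ge_2 by (simp add: power2_eq_square)
  also have "\<dots> \<le> 1 / 8"
    using four_le_n_sq by (simp add: divide_le_eq)
  finally show ?thesis .
qed

lemma expected_cover_time_ge:
  assumes "x \<in> V" "2 * ln n - ln 4 \<ge> 0"
  shows "ennreal (real n ^ 2 / 2 * (2 * ln n - ln 4) * (7 / 8) - 1) \<le>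
    (\<integral>\<^sup>+\<omega>. pair_cover_time V \<omega> \<partial>markov_path (edgelighter V q1 q2) (x, G))"
proof -
  define k where "k = nat \<lceil>2 * (real n ^ 2 * ln n)\<rceil>"
  have k: "2 * (real n ^ 2 * ln n) \<le> k"
    unfolding k_def by linarith
  have "real n ^ 2 / 2 * (2 * ln n - ln 4) * (7 / 8) \<le> real n ^ 2 / 2 * harm N * (1 - uncovered_prob V x (2 * k))"
    using assms(2) harm_N_ge uncovered_prob_eighth[OF assms(1) k] by (intro mult_mono) auto
  then have "ennreal (real n ^ 2 / 2 * (2 * ln n - ln 4) * (7 / 8) - 1) \<le> ennreal (\<Sum>t<2 * k. uncovered_prob V x t)"
    using sum_uncovered_prob_ge[OF assms(1), of "2 * k"] by (intro ennreal_leI) simp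
  also have "\<dots> \<le> (\<Sum>t. ennreal (uncovered_prob V x t))"
    by (simp add: uncovered_prob_nonneg sum_le_suminf flip: sum_ennreal)
  finally show ?thesis
    unfolding expected_cover_time_eq[OF finite_V V_ne] .
qed

text \<open>The hypotheses isolate what is needed from large n. For the lower bound on the maximum a
  single starting vertex suffices.\<close>

lemma max_expected_cover_time_bounds:
  assumes "1/2 * real n ^ 2 * ln n \<le> real n ^ 2 / 2 * (2 * ln n - ln 4) * (7 / 8) - 1"
    and "2 * ln n - ln 4 \<ge> 0"
    and "2 * (real n ^ 2 * ln n + 1) + real n ^ 2 / 2 \<le> 5/2 * real n ^ 2 * ln n"
  shows "ennreal (1/2 * real n ^ 2 * ln n) \<le> max_expected_cover_time V q1 q2 G"
    and "max_expected_cover_time V q1 q2 G \<le> ennreal (5/2 * real n ^ 2 * ln n)"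
proof -
  show "max_expected_cover_time V q1 q2 G \<le> ennreal (5/2 * real n ^ 2 * ln n)"
    unfolding max_expected_cover_time_def
    using finite_V V_ne order_trans[OF expected_cover_time_le ennreal_leI[OF assms(3)]] by simp
  obtain x where x: "x \<in> V" using V_ne by auto
  then show "ennreal (1/2 * real n ^ 2 * ln n) \<le> max_expected_cover_time V q1 q2 G"
    unfolding max_expected_cover_time_def
    using finite_V order_trans[OF ennreal_leI[OF assms(1)] expected_cover_time_ge[OF x assms(2)]]
    by (subst Max_ge_iff) auto
qed

end

text \<open>The coefficients of n^2 ln n are 1/2 against 7/8 in the first claim and 2 against 5/2 in
  the last.\<close>

lemma cover_asymptotics:
  shows "\<forall>\<^sub>F n in sequentially. 1/2 * real n ^ 2 * ln n \<le> real n ^ 2 / 2 * (2 * ln n - ln 4) * (7 / 8) - 1"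
    and "\<forall>\<^sub>F n in sequentially. 2 * ln (real n) - ln 4 \<ge> 0"
    and "\<forall>\<^sub>F n in sequentially. 2 * (real n ^ 2 * ln n + 1) + real n ^ 2 / 2 \<le> 5/2 * real n ^ 2 * ln n"
  by real_asymp+

section \<open>Total variation and stationary distributions\<close>

text \<open>The error of a mixture is at most the average error. Letting \<open>e\<close> depend on
  \<open>x\<close> allows both an indicator of a bad event and a Markov-type bound.\<close>

lemma abs_prob_bind_diff_le:
  assumes "\<And>x. x \<in> set_pmf p \<Longrightarrow> \<bar>measure_pmf.prob (f x) A - c\<bar> \<le> e x"
    and "integrable (measure_pmf p) e"
  shows "\<bar>measure_pmf.prob (bind_pmf p f) A - c\<bar> \<le> measure_pmf.expectation p e"
proof -
  have int: "integrable (measure_pmf p) (\<lambda>x. measure_pmf.prob (f x) A)"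
    by (rule measure_pmf.integrable_const_bound[where B = 1]) auto
  have "ennreal (measure_pmf.prob (bind_pmf p f) A) = (\<integral>\<^sup>+x. ennreal (measure_pmf.prob (f x) A) \<partial>p)"
    by (simp flip: measure_pmf.emeasure_eq_measure)
  also have "\<dots> = ennreal (measure_pmf.expectation p (\<lambda>x. measure_pmf.prob (f x) A))"
    using int by (intro nn_integral_eq_integral) auto
  finally have "measure_pmf.prob (bind_pmf p f) A = measure_pmf.expectation p (\<lambda>x. measure_pmf.prob (f x) A)"
    by (simp add: integral_nonneg_AE)
  then have "measure_pmf.prob (bind_pmf p f) A - c = measure_pmf.expectation p (\<lambda>x. measure_pmf.prob (f x) A - c)"
    using int by simp
  also have "\<bar>\<dots>\<bar> \<le> measure_pmf.expectation p (\<lambda>x. \<bar>measure_pmf.prob (f x) A - c\<bar>)"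
    by (rule integral_abs_bound)
  also have "\<dots> \<le> measure_pmf.expectation p e"
    using assms int by (intro integral_mono_AE) (auto simp: AE_measure_pmf_iff)
  finally show ?thesis .
qed

lemma total_variation_ge: "\<bar>measure_pmf.prob p A - measure_pmf.prob q A\<bar> \<le> total_variation p q"
  unfolding total_variation_def
proof (rule cSUP_upper)
  have "\<bar>measure_pmf.prob p A - measure_pmf.prob q A\<bar> \<le> 1" for A
    using measure_pmf.prob_le_1[of p A] measure_pmf.prob_le_1[of q A]
      measure_nonneg[of "measure_pmf p" A] measure_nonneg[of "measure_pmf q" A]
    by linarith
  then show "bdd_above (range (\<lambda>A. \<bar>measure_pmf.prob p A - measure_pmf.prob q A\<bar>))"
    by (intro bdd_aboveI[of _ 1]) auto
qed simp

lemma total_variation_le: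
  "(\<And>A. \<bar>measure_pmf.prob p A - measure_pmf.prob q A\<bar> \<le> e) \<Longrightarrow> total_variation p q \<le> e"
  unfolding total_variation_def by (intro cSUP_least) auto

lemma bind_kernel_power:
  assumes "bind_pmf p K = p"
  shows "bind_pmf p (kernel_power K t) = p"
proof (induction t)
  case (Suc t)
  have "bind_pmf p (kernel_power K (Suc t)) = bind_pmf (bind_pmf p (kernel_power K t)) K"
    unfolding bind_assoc_pmf by (intro bind_pmf_cong refl) simp
  then show ?case by (simp only: Suc assms)
next
  case 0
  have "bind_pmf p (kernel_power K 0) = bind_pmf p return_pmf"
    by (intro bind_pmf_cong refl) simp
  then show ?case by (simp add: bind_return_pmf')
qed

text \<open>Any stationary law p on \<open>S\<close> is a p-mixture of the laws at time
  \<open>\<tau> t\<close>, all within \<open>e t\<close> of \<open>\<pi>\<close>, so p equals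
  \<open>\<pi>\<close>. Convergence along the times \<open>\<tau>\<close> is enough for this
  uniqueness.\<close>

lemma stationary_distribution_eqI:
  assumes \<pi>: "set_pmf \<pi> \<subseteq> S" "bind_pmf \<pi> K = \<pi>"
    and conv: "\<And>x t A. x \<in> S \<Longrightarrow> \<bar>measure_pmf.prob (kernel_power K (\<tau> t) x) A - measure_pmf.prob \<pi> A\<bar> \<le> e t"
    and e: "e \<longlonglongrightarrow> 0"
  shows "stationary_distribution S K = \<pi>"
  unfolding stationary_distribution_def
proof (rule the_equality)
  fix p assume p: "set_pmf p \<subseteq> S \<and> bind_pmf p K = p"
  show "p = \<pi>"
  proof (rule pmf_eqI)
    fix a
    have "\<bar>measure_pmf.prob p {a} - measure_pmf.prob \<pi> {a}\<bar> \<le> e t" for t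
      using abs_prob_bind_diff_le[of p "kernel_power K (\<tau> t)" "{a}" "measure_pmf.prob \<pi> {a}" "\<lambda>_. e t"] p conv
      by (auto simp: bind_kernel_power)
    then have "\<bar>measure_pmf.prob p {a} - measure_pmf.prob \<pi> {a}\<bar> \<le> 0"
      by (intro LIMSEQ_le_const[OF e]) auto
    then show "pmf p a = pmf \<pi> a" by (simp add: measure_pmf_single)
  qed
qed (use \<pi> in auto)

section \<open>Resampling of pairs\<close>

lemma map_Not_bernoulli_pmf:
  assumes "0 \<le> q" "q \<le> 1"
  shows "map_pmf Not (bernoulli_pmf q) = bernoulli_pmf (1 - q)"
proof (rule pmf_eqI)
  fix b
  have "pmf (map_pmf Not (bernoulli_pmf q)) (\<not> \<not> b) = pmf (bernoulli_pmf q) (\<not> b)"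
    by (rule pmf_map_inj') (auto simp: inj_def)
  then show "pmf (map_pmf Not (bernoulli_pmf q)) b = pmf (bernoulli_pmf (1 - q)) b"
    using assms by (cases b) auto
qed

definition set_edge :: "'e \<Rightarrow> bool \<Rightarrow> 'e set \<Rightarrow> 'e set" where
  "set_edge e b G = (if b then insert e G else G - {e})"

text \<open>
  The graph with initial edges \<open>G\<close> after the pairs in \<open>C\<close> have been resampled
  according to \<open>R\<close>.
\<close>

definition resample :: "'e set \<Rightarrow> 'e set \<Rightarrow> 'e set \<Rightarrow> 'e set" where
  "resample G C R = (G - C) \<union> (R \<inter> C)"

text \<open>For \<open>P = pairs\<close> this is the Erdos-Renyi random graph with edge probability
  \<open>q\<close>.\<close>

definition random_edges :: "'e set \<Rightarrow> real \<Rightarrow> 'e set pmf" where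
  "random_edges P q = map_pmf (\<lambda>f. {e \<in> P. f e}) (Pi_pmf P False (\<lambda>_. bernoulli_pmf q))"

lemma set_edge_resample: "set_edge e b (resample G C R) = resample G (insert e C) (set_edge e b R)"
  by (auto simp: set_edge_def resample_def)

lemma set_random_edges: "R \<in> set_pmf (random_edges P q) \<Longrightarrow> R \<subseteq> P"
  by (auto simp: random_edges_def)

text \<open>Under the product law the status of \<open>e\<close> is independent of the rest, so
  replacing it by a fresh copy changes nothing.\<close>

lemma random_edges_refresh:
  assumes "finite P" "e \<in> P"
  shows "bind_pmf (random_edges P q) (\<lambda>R. map_pmf (\<lambda>b. set_edge e b R) (bernoulli_pmf q)) = random_edges P q"
proof -
  have P: "P = insert e (P - {e})" using assms(2) by auto
  let ?Q = "Pi_pmf (P - {e}) False (\<lambda>_. bernoulli_pmf q)"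
  have Pi: "Pi_pmf P False (\<lambda>_. bernoulli_pmf q) =
      bind_pmf (bernoulli_pmf q) (\<lambda>y. map_pmf (\<lambda>f. f(e := y)) ?Q)"
    using assms(1) by (subst P, subst Pi_pmf_insert') (auto simp: map_pmf_def)
  have eq: "random_edges P q = bind_pmf (bernoulli_pmf q) (\<lambda>y. map_pmf (\<lambda>f. set_edge e y {e' \<in> P - {e}. f e'}) ?Q)"
    unfolding random_edges_def Pi map_bind_pmf pmf.map_comp o_def
    using assms(2) by (intro bind_pmf_cong map_pmf_cong refl) (auto simp: set_edge_def)
  \<comment> \<open>The fresh bit overwrites the old value \<open>y\<close>, whose draw then
    integrates out.\<close>
  have "bind_pmf (random_edges P q) (\<lambda>R. map_pmf (\<lambda>b. set_edge e b R) (bernoulli_pmf q)) =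
    bind_pmf (bernoulli_pmf q) (\<lambda>y. bind_pmf ?Q (\<lambda>f. map_pmf (\<lambda>b. set_edge e b {e' \<in> P - {e}. f e'}) (bernoulli_pmf q)))"
    unfolding eq bind_assoc_pmf bind_map_pmf
    by (intro bind_pmf_cong map_pmf_cong refl) (auto simp: set_edge_def)
  also have "\<dots> = bind_pmf ?Q (\<lambda>f. map_pmf (\<lambda>b. set_edge e b {e' \<in> P - {e}. f e'}) (bernoulli_pmf q))"
    by simp
  also have "\<dots> = random_edges P q"
    unfolding eq map_pmf_def by (rule bind_commute_pmf)
  finally show ?thesis .
qed

lemma card_random_edges:
  assumes "finite P" "C \<subseteq> P" "0 \<le> q" "q \<le> 1"
  shows "map_pmf (\<lambda>R. card (R \<inter> C)) (random_edges P q) = binomial_pmf (card C) q"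
proof -
  have "binomial_pmf (card C) q = map_pmf (\<lambda>f. card {e \<in> C. f e}) (Pi_pmf C False (\<lambda>_. bernoulli_pmf q))"
    using assms by (intro binomial_pmf_altdef') (auto intro: finite_subset)
  also have "\<dots> = map_pmf (\<lambda>R. card (R \<inter> C)) (random_edges P q)"
    unfolding random_edges_def Pi_pmf_subset[OF assms(1,2)] pmf.map_comp o_def
    using assms(2) by (intro map_pmf_cong refl arg_cong[of _ _ card]) auto
  finally show ?thesis by simp
qed

text \<open>This is where \<open>q1 = 1 - q2\<close> enters: removal with probability
  \<open>1 - q\<close> means presence with probability \<open>q\<close>, exactly as for an absent
  pair.\<close>

lemma edgelighter_eq:
  assumes "0 \<le> q" "q \<le> 1"
  shows "edgelighter V (1 - q) q (u, G) = bind_pmf (pmf_of_set V) (\<lambda>v.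
    if v = u then return_pmf (v, G) else map_pmf (\<lambda>b. (v, set_edge {u, v} b G)) (bernoulli_pmf q))"
proof -
  have "map_pmf (\<lambda>switch. (v, if switch then G - {{u, v}} else G)) (bernoulli_pmf (1 - q)) =
    map_pmf (\<lambda>b. (v, set_edge {u, v} b G)) (bernoulli_pmf q)" if "{u, v} \<in> G" for v
    unfolding map_Not_bernoulli_pmf[OF assms, symmetric] pmf.map_comp o_def
    using that by (intro map_pmf_cong refl) (auto simp: set_edge_def)
  moreover have "map_pmf (\<lambda>switch. (v, if switch then insert {u, v} G else G)) (bernoulli_pmf q) =
    map_pmf (\<lambda>b. (v, set_edge {u, v} b G)) (bernoulli_pmf q)" if "{u, v} \<notin> G" for v
    using that by (intro map_pmf_cong refl) (auto simp: set_edge_def)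
  ultimately show ?thesis
    unfolding edgelighter_def prod.case by (intro bind_pmf_cong refl) auto
qed

context vertex_set
begin

subsection \<open>Law of the edgelighter walk\<close>

abbreviation "states \<equiv> edgelighter_states V"

definition resampled_law :: "real \<Rightarrow> 'v set set \<Rightarrow> 'v \<times> 'v set set \<Rightarrow> ('v \<times> 'v set set) pmf" where
  "resampled_law q G = (\<lambda>(u, C). map_pmf (\<lambda>R. (u, resample G C R)) (random_edges pairs q))"

definition edgelighter_stationary :: "real \<Rightarrow> ('v \<times> 'v set set) pmf" where
  "edgelighter_stationary q = bind_pmf (pmf_of_set V) (\<lambda>u. map_pmf (Pair u) (random_edges pairs q))"

text \<open>Intertwining of the two chains: a traversal puts the pair into \<open>C\<close> by
  \<open>set_edge_resample\<close> and refreshes one coordinate of the random graph, which keeps its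
  law by \<open>random_edges_refresh\<close>.\<close>

lemma bind_resampled_law:
  assumes q: "0 \<le> q" "q \<le> 1" and u: "u \<in> V"
  shows "bind_pmf (resampled_law q G (u, C)) (edgelighter V (1 - q) q) =
    bind_pmf (walk_cover V (u, C)) (resampled_law q G)"
proof -
  let ?R = "random_edges pairs q"
  let ?step = "\<lambda>v G'. if v = u then return_pmf (v, G')
    else map_pmf (\<lambda>b. (v, set_edge {u, v} b G')) (bernoulli_pmf q)"
  have "bind_pmf (resampled_law q G (u, C)) (edgelighter V (1 - q) q) =
    bind_pmf ?R (\<lambda>R. bind_pmf (pmf_of_set V) (\<lambda>v. ?step v (resample G C R)))"
    by (simp add: resampled_law_def bind_map_pmf edgelighter_eq[OF q])
  \<comment> \<open>The destination is independent of the resampled graph and may be drawn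
    first.\<close>
  also have "\<dots> = bind_pmf (pmf_of_set V) (\<lambda>v. bind_pmf ?R (\<lambda>R. ?step v (resample G C R)))"
    by (rule bind_commute_pmf)
  also have "\<dots> = bind_pmf (pmf_of_set V) (\<lambda>v. resampled_law q G (v, cover_step u v C))"
  proof (intro bind_pmf_cong refl)
    fix v assume "v \<in> set_pmf (pmf_of_set V)"
    then have v: "v \<in> V" using finite_V V_ne by simp
    show "bind_pmf ?R (\<lambda>R. ?step v (resample G C R)) = resampled_law q G (v, cover_step u v C)"
    proof (cases "v = u")
      case True
      then show ?thesis by (simp add: resampled_law_def cover_step_def map_pmf_def)
    next
      case False
      then have "{u, v} \<in> pairs" using pair_in_pairs[OF u v] by simp
      have "bind_pmf ?R (\<lambda>R. ?step v (resample G C R)) =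
        map_pmf (\<lambda>R. (v, resample G (insert {u, v} C) R))
          (bind_pmf ?R (\<lambda>R. map_pmf (\<lambda>b. set_edge {u, v} b R) (bernoulli_pmf q)))"
        using False by (simp add: map_bind_pmf pmf.map_comp o_def set_edge_resample)
      then show ?thesis
        using False random_edges_refresh[OF finite_pairs \<open>{u, v} \<in> pairs\<close>, of q]
        by (simp add: resampled_law_def cover_step_def)
    qed
  qed
  also have "\<dots> = bind_pmf (walk_cover V (u, C)) (resampled_law q G)"
    by (simp add: walk_cover_def bind_map_pmf)
  finally show ?thesis .
qed

lemma kernel_power_edgelighter:
  assumes q: "0 \<le> q" "q \<le> 1" and x: "x \<in> V"
  shows "kernel_power (edgelighter V (1 - q) q) t (x, G) = bind_pmf (cover_law x t) (resampled_law q G)"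
proof (induction t)
  case 0
  have "map_pmf (\<lambda>R. (x, resample G {} R)) (random_edges pairs q) = return_pmf (x, G)"
    by (simp add: resample_def map_pmf_const)
  then show ?case by (simp add: bind_return_pmf resampled_law_def)
next
  case (Suc t)
  have "kernel_power (edgelighter V (1 - q) q) (Suc t) (x, G) =
    bind_pmf (cover_law x t) (\<lambda>s. bind_pmf (resampled_law q G s) (edgelighter V (1 - q) q))"
    by (simp add: Suc bind_assoc_pmf)
  also have "\<dots> = bind_pmf (cover_law x t) (\<lambda>s. bind_pmf (walk_cover V s) (resampled_law q G))"
  proof (rule bind_pmf_cong[OF refl])
    fix s assume "s \<in> set_pmf (cover_law x t)"
    then show "bind_pmf (resampled_law q G s) (edgelighter V (1 - q) q) =
        bind_pmf (walk_cover V s) (resampled_law q G)"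
      using cover_law_support(1)[OF x] bind_resampled_law[OF q] by (cases s) simp
  qed
  finally show ?case by (simp add: bind_assoc_pmf)
qed

text \<open>With all pairs resampled the initial graph is forgotten, and the step makes the position
  uniform whatever \<open>u\<close> was.\<close>

lemma bind_walk_cover_pairs:
  assumes "u \<in> V" "G \<subseteq> pairs"
  shows "bind_pmf (walk_cover V (u, pairs)) (resampled_law q G) = edgelighter_stationary q"
  unfolding walk_cover_def edgelighter_stationary_def prod.case bind_map_pmf
proof (intro bind_pmf_cong refl)
  fix v assume "v \<in> set_pmf (pmf_of_set V)"
  then have "cover_step u v pairs = pairs"
    using assms(1) finite_V V_ne pair_in_pairs[of u v] by (auto simp: cover_step_def)
  moreover have "resample G pairs R = R" if "R \<in> set_pmf (random_edges pairs q)" for R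
    using set_random_edges[OF that] assms(2) by (auto simp: resample_def)
  ultimately show "resampled_law q G (v, cover_step u v pairs) = map_pmf (Pair v) (random_edges pairs q)"
    by (auto simp: resampled_law_def intro!: map_pmf_cong)
qed

text \<open>The candidate law is a mixture of fully resampled laws, to which the intertwining
  applies.\<close>

lemma bind_edgelighter_stationary:
  assumes q: "0 \<le> q" "q \<le> 1"
  shows "bind_pmf (edgelighter_stationary q) (edgelighter V (1 - q) q) = edgelighter_stationary q"
proof -
  have "bind_pmf (edgelighter_stationary q) (edgelighter V (1 - q) q) =
    bind_pmf (pmf_of_set V) (\<lambda>u. bind_pmf (resampled_law q {} (u, pairs)) (edgelighter V (1 - q) q))"
    unfolding edgelighter_stationary_def bind_assoc_pmf
    by (intro bind_pmf_cong refl arg_cong2[of _ _ _ _ bind_pmf])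
       (auto simp: resampled_law_def resample_def dest: set_random_edges intro!: map_pmf_cong)
  also have "\<dots> = bind_pmf (pmf_of_set V) (\<lambda>u. edgelighter_stationary q)"
    using finite_V V_ne
    by (intro bind_pmf_cong refl) (simp add: bind_resampled_law[OF q] bind_walk_cover_pairs)
  finally show ?thesis by simp
qed

lemma set_edgelighter_stationary: "set_pmf (edgelighter_stationary q) \<subseteq> states"
  using finite_V V_ne by (auto simp: edgelighter_stationary_def edgelighter_states_def dest: set_random_edges)

text \<open>
  If all pairs are traversed by time \<open>t\<close>, then the graph is fully resampled, and the position
  at time \<open>t + 1\<close> is uniform and independent of the walk up to time \<open>t\<close>.
\<close>

lemma edgelighter_near_stationary:
  assumes q: "0 \<le> q" "q \<le> 1" and x: "x \<in> V" and G: "G \<subseteq> pairs"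
  shows "\<bar>measure_pmf.prob (kernel_power (edgelighter V (1 - q) q) (Suc t) (x, G)) A -
    measure_pmf.prob (edgelighter_stationary q) A\<bar> \<le> uncovered_prob V x t"
proof -
  have "kernel_power (edgelighter V (1 - q) q) (Suc t) (x, G) =
    bind_pmf (cover_law x t) (\<lambda>s. bind_pmf (walk_cover V s) (resampled_law q G))"
    unfolding kernel_power_edgelighter[OF q x] by (simp add: bind_assoc_pmf)
  moreover have "\<bar>measure_pmf.prob (bind_pmf (walk_cover V s) (resampled_law q G)) A -
    measure_pmf.prob (edgelighter_stationary q) A\<bar> \<le> (case s of (u, C) \<Rightarrow> of_bool (\<not> pairs \<subseteq> C))"
    if "s \<in> set_pmf (cover_law x t)" for s
  proof -
    obtain u C where s: "s = (u, C)" by force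
    show ?thesis
    proof (cases "pairs \<subseteq> C")
      case True
      then have "C = pairs" "u \<in> V" using cover_law_support[OF x, of u C t] that s by auto
      then show ?thesis by (simp add: s bind_walk_cover_pairs G)
    next
      case False
      have "\<bar>a - b\<bar> \<le> 1" if "0 \<le> a" "a \<le> 1" "0 \<le> b" "b \<le> 1" for a b :: real
        using that by linarith
      then show ?thesis using False by (simp add: s)
    qed
  qed
  ultimately show ?thesis
    unfolding uncovered_prob_eq_expectation
    by (simp only:) (intro abs_prob_bind_diff_le integrable_measure_pmf_finite finite_cover_law)
qed

text \<open>The geometric bound at the odd times 2k + 1, uniform over the starting states, forces
  uniqueness.\<close>

lemma stationary_distribution_edgelighter:
  assumes q: "0 \<le> q" "q \<le> 1"
  shows "stationary_distribution states (edgelighter V (1 - q) q) = edgelighter_stationary q"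
proof (rule stationary_distribution_eqI)
  show "set_pmf (edgelighter_stationary q) \<subseteq> states"
    by (rule set_edgelighter_stationary)
  show "bind_pmf (edgelighter_stationary q) (edgelighter V (1 - q) q) = edgelighter_stationary q"
    by (rule bind_edgelighter_stationary[OF q])
  show "\<bar>measure_pmf.prob (kernel_power (edgelighter V (1 - q) q) (Suc (2 * k)) s) A -
    measure_pmf.prob (edgelighter_stationary q) A\<bar> \<le> N * (1 - 2 / real n ^ 2) ^ k"
    if "s \<in> states" for s k A
    using that edgelighter_near_stationary[OF q, of "fst s" "snd s" "2 * k" A] uncovered_prob_bound[of "fst s" k]
    by (auto simp: edgelighter_states_def)
  show "(\<lambda>k. N * (1 - 2 / real n ^ 2) ^ k) \<longlonglongrightarrow> 0"
    using four_le_n_sq n_ge_2 by (intro tendsto_mult_right_zero LIMSEQ_power_zero) (simp add: abs_if divide_le_eq)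
qed

end

text \<open>H_k - ln k decreases in k and equals 1 at k = 1.\<close>

lemma harm_le_ln:
  assumes "k > 0"
  shows "harm k \<le> 1 + ln (real k)"
proof -
  obtain m where k: "k = Suc m" using assms by (cases k) auto
  have "harm (Suc m) - ln (Suc m) \<le> harm (Suc 0) - ln (Suc 0)"
    using decseq_harm_diff_ln by (rule decseqD) simp
  then show ?thesis by (simp add: k harm_expand)
qed

context vertex_set
begin

subsection \<open>Bounds on the mixing time\<close>

lemma finite_states: "finite states"
  using finite_V finite_pairs by (simp add: edgelighter_states_def)

lemma states_ne: "states \<noteq> {}"
  using V_ne by (auto simp: edgelighter_states_def)

abbreviation "edgelighter_distance q t \<equiv>
  MAX s\<in>states. total_variation (kernel_power (edgelighter V (1 - q) q) t s) (edgelighter_stationary q)"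

lemma edgelighter_distance_le:
  assumes q: "0 \<le> q" "q \<le> 1" and k: "2 * (real n ^ 2 * ln n) \<le> k"
  shows "edgelighter_distance q (Suc (2 * k)) < 1 / 4"
proof -
  have "total_variation (kernel_power (edgelighter V (1 - q) q) (Suc (2 * k)) s) (edgelighter_stationary q) \<le> 1 / 8"
    if s: "s \<in> states" for s
  proof (rule total_variation_le)
    obtain x G where xG: "s = (x, G)" "x \<in> V" "G \<subseteq> pairs"
      using s by (auto simp: edgelighter_states_def)
    show "\<bar>measure_pmf.prob (kernel_power (edgelighter V (1 - q) q) (Suc (2 * k)) s) A -
      measure_pmf.prob (edgelighter_stationary q) A\<bar> \<le> 1 / 8" for A
      unfolding xG(1)
      using edgelighter_near_stationary[OF q xG(2,3)] uncovered_prob_eighth[OF xG(2) k] by (rule order_trans)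
  qed
  then have "edgelighter_distance q (Suc (2 * k)) \<le> 1 / 8"
    using finite_states states_ne by (subst Max_le_iff) (auto simp del: kernel_power.simps)
  then show ?thesis by linarith
qed

lemma edgelighter_mixing_time_le:
  assumes q: "0 \<le> q" "q \<le> 1" and k: "2 * (real n ^ 2 * ln n) \<le> k"
  shows "edgelighter_mixing_time V (1 - q) q \<le> Suc (2 * k)"
  unfolding edgelighter_mixing_time_def mixing_time_def stationary_distribution_edgelighter[OF q]
  by (intro Least_le edgelighter_distance_le assms)

text \<open>\<open>edgelighter_distance_le\<close> exhibits a time with small distance, so the least
  such time is attained.\<close>

lemma edgelighter_distance_mixing_time:
  assumes q: "0 \<le> q" "q \<le> 1"
  shows "edgelighter_distance q (edgelighter_mixing_time V (1 - q) q) < 1 / 4"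
proof -
  have "2 * (real n ^ 2 * ln n) \<le> nat \<lceil>2 * (real n ^ 2 * ln n)\<rceil>"
    by linarith
  then show ?thesis
    unfolding edgelighter_mixing_time_def mixing_time_def stationary_distribution_edgelighter[OF q]
    by (rule LeastI[of "\<lambda>t. edgelighter_distance q t < 1 / 4", OF edgelighter_distance_le[OF q]])
qed

abbreviation dense_states :: "real \<Rightarrow> real \<Rightarrow> ('v \<times> 'v set set) set" where
  "dense_states q s \<equiv> {(u, G). real N * q + s \<le> real (card (G \<inter> pairs))}"

lemma prob_dense_stationary:
  assumes q: "0 \<le> q" "q \<le> 1" and s: "0 \<le> s"
  shows "measure_pmf.prob (edgelighter_stationary q) (dense_states q s) \<le> exp (- 2 * s\<^sup>2 / N)"
proof -
  interpret binomial_distribution N q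
    by unfold_locales (use q in auto)
  have "measure_pmf.prob (random_edges pairs q) {R. N * q + s \<le> card (R \<inter> pairs)} \<le> exp (- 2 * s\<^sup>2 / N)"
    using prob_ge[OF N_pos s]
    by (simp flip: card_random_edges[OF finite_pairs subset_refl q])
  then have "\<bar>measure_pmf.prob (edgelighter_stationary q) (dense_states q s) - 0\<bar> \<le>
    measure_pmf.expectation (pmf_of_set V) (\<lambda>_. exp (- 2 * s\<^sup>2 / N))"
    unfolding edgelighter_stationary_def by (intro abs_prob_bind_diff_le) (auto simp: vimage_def)
  then show ?thesis by simp
qed

text \<open>With k untraversed pairs, the edge count is k plus a binomial variable on
  \<open>card C\<close> trials. Its mean is N q + (1 - q) k, at least N q + 2 s, so a sparse graph
  is a downward deviation by \<open>s\<close>; Hoeffding's inequality applies.\<close>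

lemma prob_sparse_resampled:
  fixes q s :: real
  assumes q: "0 \<le> q" "q \<le> 1" and s: "0 \<le> s" "2 * s \<le> (1 - q) * card (pairs - C)" and C: "C \<subseteq> pairs"
  shows "measure_pmf.prob (resampled_law q pairs (u, C)) (- dense_states q s) \<le> exp (- 2 * s\<^sup>2 / N)"
proof -
  interpret binomial_distribution "card C" q
    by unfold_locales (use q in auto)
  let ?k = "card (pairs - C)"
  have N: "N = ?k + card C"
    using card_Diff_subset[of C pairs] C finite_pairs card_mono[OF finite_pairs C] finite_subset[OF C] by simp
  have card: "card (resample pairs C R \<inter> pairs) = ?k + card (R \<inter> C)" for R
  proof -
    have "resample pairs C R \<inter> pairs = (pairs - C) \<union> (R \<inter> C)"
      using C by (auto simp: resample_def)
    then show ?thesis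
      using finite_pairs finite_subset[OF C] by (simp add: card_Un_disjoint Int_Diff disjoint_iff)
  qed
  have sparse: "measure_pmf.prob (resampled_law q pairs (u, C)) (- dense_states q s) =
      measure_pmf.prob (random_edges pairs q) {R. ?k + card (R \<inter> C) < N * q + s}"
    by (auto simp: resampled_law_def card vimage_def not_le intro!: arg_cong[of _ _ "measure_pmf.prob _"])
  show ?thesis
  \<comment> \<open>Hoeffding's inequality needs at least one trial. Without traversed pairs the
    graph is still complete and the event is empty.\<close>
  proof (cases "card C = 0")
    case True
    have "0 \<le> (1 - q) * ?k" using q by simp
    moreover have "\<not> ?k < N * q + s"
      using s calculation True N by (simp add: algebra_simps)
    ultimately have "{R. ?k + card (R \<inter> C) < N * q + s} = {}" by auto
    then show ?thesis unfolding sparse by simp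
  next
    case False
    have "?k + real c < N * q + s \<Longrightarrow> real c \<le> card C * q - s" for c
      using s(2) N by (simp add: algebra_simps)
    then have "measure_pmf.prob (random_edges pairs q) {R. ?k + card (R \<inter> C) < N * q + s} \<le>
      measure_pmf.prob (random_edges pairs q) {R. card (R \<inter> C) \<le> card C * q - s}"
      by (intro measure_pmf.finite_measure_mono) auto
    also have "\<dots> \<le> exp (- 2 * s\<^sup>2 / card C)"
      using prob_le[OF _ s(1)] False by (simp flip: card_random_edges[OF finite_pairs C q])
    also have "\<dots> \<le> exp (- 2 * s\<^sup>2 / N)"
      using False N by (simp add: frac_le)
    finally show ?thesis unfolding sparse .
  qed
qed

text \<open>
  By Markov's inequality, the harmonic potential has dropped by less than \<open>a\<close> with high probability.
  The hypothesis \<open>many\<close> then says that enough original edges survive to make the graph too dense.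
\<close>

lemma total_variation_complete_ge:
  fixes q s a :: real
  assumes q: "0 \<le> q" "q \<le> 1" and x: "x \<in> V" and a: "a > 0" and s: "0 \<le> s"
    and many: "\<And>k. k \<le> N \<Longrightarrow> harm N - harm k < a \<Longrightarrow> 2 * s \<le> (1 - q) * real k"
  shows "total_variation (kernel_power (edgelighter V (1 - q) q) t (x, pairs)) (edgelighter_stationary q) \<ge>
    1 - 2 * exp (- 2 * s\<^sup>2 / N) - 2 * (1 + real t) / (real n ^ 2 * a)"
proof -
  let ?K = "kernel_power (edgelighter V (1 - q) q) t (x, pairs)"
  let ?A = "dense_states q s" and ?d = "exp (- 2 * s\<^sup>2 / N)"
  \<comment> \<open>Markov's inequality in pointwise form: the first term is at least 1 if the
    potential has dropped by \<open>a\<close> or more; otherwise the Hoeffding term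
    suffices.\<close>
  let ?e = "\<lambda>z. (harm N - potential z) / a + ?d"
  have "\<bar>measure_pmf.prob (bind_pmf (cover_law x t) (resampled_law q pairs)) (- ?A) - 0\<bar> \<le>
    measure_pmf.expectation (cover_law x t) ?e"
  proof (intro abs_prob_bind_diff_le integrable_measure_pmf_finite finite_cover_law)
    fix z assume z_in: "z \<in> set_pmf (cover_law x t)"
    obtain u C where z: "z = (u, C)" by force
    have C: "C \<subseteq> pairs" using cover_law_support(2)[OF x] z_in z by blast
    have k: "card (pairs - C) \<le> N" by (intro card_mono finite_pairs) auto
    then have pot: "0 \<le> harm N - potential z"
      by (simp add: potential_def z harm_mono)
    show "\<bar>measure_pmf.prob (resampled_law q pairs z) (- ?A) - 0\<bar> \<le> ?e z"
    proof (cases "harm N - potential z < a")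
      case True
      then have "measure_pmf.prob (resampled_law q pairs z) (- ?A) \<le> ?d"
        unfolding z using many[OF k] C by (intro prob_sparse_resampled q s) (auto simp: potential_def z)
      then show ?thesis using pot a by (simp add: add_increasing)
    next
      case False
      then have "1 \<le> (harm N - potential z) / a" using a by simp
      moreover have "0 \<le> ?d" by simp
      ultimately have "measure_pmf.prob (resampled_law q pairs z) (- ?A) \<le> ?e z"
        using measure_pmf.prob_le_1[of "resampled_law q pairs z" "- ?A"] by linarith
      then show ?thesis by simp
    qed
  qed
  also have "\<dots> = (harm N - measure_pmf.expectation (cover_law x t) potential) / a + ?d"
    by (simp add: integrable_measure_pmf_finite finite_cover_law)
  also have "\<dots> \<le> (2 / real n ^ 2 * (1 + real t)) / a + ?d"
  proof -
    have "(\<Sum>s<t. uncovered_prob V x s) \<le> real t"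
      using sum_bounded_above[of "{..<t}" "uncovered_prob V x" 1] uncovered_prob_le_1 by simp
    then have "2 / real n ^ 2 * (1 + (\<Sum>s<t. uncovered_prob V x s)) \<le> 2 / real n ^ 2 * (1 + real t)"
      by (intro mult_left_mono) auto
    then show ?thesis
      using expected_potential_ge[OF x, of t] a by (intro add_right_mono divide_right_mono) auto
  qed
  finally have "measure_pmf.prob ?K (- ?A) \<le> 2 * (1 + real t) / (real n ^ 2 * a) + ?d"
    by (simp add: kernel_power_edgelighter[OF q x])
  moreover have "measure_pmf.prob ?K (- ?A) = 1 - measure_pmf.prob ?K ?A"
    using measure_pmf.prob_compl[of ?A ?K] by (simp add: Compl_eq_Diff_UNIV)
  moreover have "measure_pmf.prob ?K ?A - measure_pmf.prob (edgelighter_stationary q) ?A \<le>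
      total_variation ?K (edgelighter_stationary q)"
    using total_variation_ge[of ?K ?A "edgelighter_stationary q"] by linarith
  ultimately show ?thesis
    using prob_dense_stationary[OF q s] by linarith
qed

text \<open>The allowed drop is a = ln n / 2. Then H_k exceeds (3/2) ln n - ln 4, which by
  \<open>harm_le_ln\<close> leaves at least n^(3/2)/(4e) untraversed pairs. This number is
  \<open>?m\<close>, and \<open>?s\<close> is half the resulting excess of edges.\<close>

lemma edgelighter_mixing_time_ge:
  assumes q: "0 \<le> q" "q \<le> 1"
    and ln1: "0 \<le> 3 / 2 * ln n - ln 4"
    and ln2: "4 / (real n ^ 2 * ln n) \<le> 1 / 4"
    and dev: "exp (- 2 * ((1 - q) * exp (3 / 2 * ln n - ln 4 - 1) / 2)\<^sup>2 / (real n ^ 2 / 2)) \<le> 1 / 8"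
  shows "real n ^ 2 * ln n / 64 \<le> edgelighter_mixing_time V (1 - q) q"
proof (rule ccontr)
  let ?t = "edgelighter_mixing_time V (1 - q) q"
  let ?m = "exp (3 / 2 * ln n - ln 4 - 1)"
  let ?s = "(1 - q) * ?m / 2"
  assume "\<not> real n ^ 2 * ln n / 64 \<le> ?t"
  then have t: "real ?t \<le> real n ^ 2 * ln n / 64" by simp
  have lnn: "0 < ln (real n)" using n_ge_2 by simp
  obtain x where x: "x \<in> V" using V_ne by auto
  have many: "2 * ?s \<le> (1 - q) * real k" if "k \<le> N" "harm N - harm k < ln (real n) / 2" for k
  proof -
    have h: "3 / 2 * ln n - ln 4 < harm k" using that(2) harm_N_ge by simp
    then have k: "k > 0" using ln1 by (cases k) (auto simp: harm_expand)
    then have "3 / 2 * ln n - ln 4 - 1 \<le> ln (real k)" using h harm_le_ln[OF k] by simp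
    then have "?m \<le> exp (ln (real k))" by simp
    then have "?m \<le> real k" using k by simp
    then show ?thesis using mult_left_mono[of ?m "real k" "1 - q"] q by simp
  qed
  have "2 * ?s\<^sup>2 / (real n ^ 2 / 2) \<le> 2 * ?s\<^sup>2 / N"
    using N_le N_pos n_ge_2 by (intro divide_left_mono) auto
  then have "- 2 * ?s\<^sup>2 / N \<le> - 2 * ?s\<^sup>2 / (real n ^ 2 / 2)"
    by simp
  then have dev': "exp (- 2 * ?s\<^sup>2 / N) \<le> 1 / 8"
    using dev by (meson exp_le_cancel_iff order_trans)
  have "2 * (1 + real ?t) / (real n ^ 2 * (ln n / 2)) = 4 / (real n ^ 2 * ln n) + 4 * real ?t / (real n ^ 2 * ln n)"
    using n_ge_2 lnn by (simp add: field_simps)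
  also have "4 * real ?t / (real n ^ 2 * ln n) \<le> 1 / 16"
    using t n_ge_2 lnn by (simp add: field_simps)
  \<comment> \<open>The losses are 2/8, 1/4 and 1/16, which leaves 7/16.\<close>
  finally have "1 / 4 \<le> total_variation (kernel_power (edgelighter V (1 - q) q) ?t (x, pairs)) (edgelighter_stationary q)"
    using total_variation_complete_ge[OF q x, of "ln n / 2" ?s ?t] many dev' ln2 lnn q by simp
  also have "\<dots> \<le> edgelighter_distance q ?t"
    using x finite_states by (intro Max_ge) (auto simp: edgelighter_states_def)
  finally show False
    using edgelighter_distance_mixing_time[OF q] by simp
qed

end

section \<open>Asymptotic inequalities and conclusion\<close>

lemma mixing_asymptotics:
  shows "\<forall>\<^sub>F n in sequentially. 0 \<le> 3 / 2 * ln (real n) - ln 4"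
    and "\<forall>\<^sub>F n in sequentially. 4 / (real n ^ 2 * ln (real n)) \<le> 1 / 4"
    and "\<forall>\<^sub>F n in sequentially. 2 * (2 * (real n ^ 2 * ln (real n)) + 1) + 1 \<le> 5 * (real n ^ 2 * ln (real n))"
  by real_asymp+

text \<open>The squared deviation is of order n^3 and is divided by n^2/2, so the exponent is
  exactly - d n for a constant d > 0.\<close>

lemma deviation_asymptotics:
  fixes c :: real
  assumes "c > 0"
  shows "\<forall>\<^sub>F n in sequentially.
    exp (- 2 * (c * exp (3 / 2 * ln (real n) - ln 4 - 1) / 2)\<^sup>2 / (real n ^ 2 / 2)) \<le> 1 / 8"
proof -
  define d where "d = c\<^sup>2 * exp (- 2 * ln 4 - 2)"
  have "d > 0" using assms by (simp add: d_def)
  then have "\<forall>\<^sub>F n in sequentially. exp (- d * real n) \<le> 1 / 8"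
    by real_asymp
  then show ?thesis
    using eventually_ge_at_top[of 1]
  proof eventually_elim
    case (elim n)
    have "exp (3 * ln (real n)) = real n ^ 3"
      using elim(2) by (simp add: exp_of_nat_mult[of 3, simplified])
    moreover have "(exp (3 / 2 * ln (real n) - ln 4 - 1))\<^sup>2 = exp (3 * ln (real n)) * exp (- 2 * ln 4 - 2)"
      by (simp add: power2_eq_square flip: exp_add)
    ultimately have "(c * exp (3 / 2 * ln (real n) - ln 4 - 1))\<^sup>2 = d * real n ^ 3"
      by (simp only: power_mult_distrib d_def mult_ac)
    then have "- 2 * (c * exp (3 / 2 * ln (real n) - ln 4 - 1) / 2)\<^sup>2 / (real n ^ 2 / 2) = - d * real n"
      using elim(2) by (simp only: power_divide) (simp add: field_simps power2_eq_square power3_eq_cube)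
    then show ?case using elim(1) by simp
  qed
qed

theorem mainTheorem4:
  fixes q1 q2 :: real and V :: "nat \<Rightarrow> 'v set"
  assumes "0 < q1" "q1 < 1" "0 < q2" "q2 < 1" "q1 = 1 - q2"
    and "\<And>n. n \<ge> 2 \<Longrightarrow> finite (V n) \<and> card (V n) = n"
  shows "(\<forall>\<^sub>F n in sequentially. \<forall>G \<subseteq> vertex_pairs (V n).
            ennreal (1/2 * real n ^ 2 * ln (real n)) \<le> max_expected_cover_time (V n) q1 q2 G \<and>
            max_expected_cover_time (V n) q1 q2 G \<le> ennreal (5/2 * real n ^ 2 * ln (real n)))
       \<and> (\<lambda>n. real (edgelighter_mixing_time (V n) q1 q2)) \<in> \<Theta>(\<lambda>n. real n ^ 2 * ln (real n))"
proof
  have V: "vertex_set (V n) n" if "n \<ge> 2" for n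
    using assms(6)[OF that] that by unfold_locales auto
  have q: "0 \<le> q2" "q2 \<le> 1" "0 < 1 - q2" using assms by auto
  show "\<forall>\<^sub>F n in sequentially. \<forall>G \<subseteq> vertex_pairs (V n).
            ennreal (1/2 * real n ^ 2 * ln (real n)) \<le> max_expected_cover_time (V n) q1 q2 G \<and>
            max_expected_cover_time (V n) q1 q2 G \<le> ennreal (5/2 * real n ^ 2 * ln (real n))"
    using cover_asymptotics eventually_ge_at_top[of 2]
    by eventually_elim (use vertex_set.max_expected_cover_time_bounds[OF V] in blast)
  have lower: "\<forall>\<^sub>F n in sequentially. real n ^ 2 * ln n / 64 \<le> edgelighter_mixing_time (V n) q1 q2"
    using mixing_asymptotics(1,2) deviation_asymptotics[OF q(3)] eventually_ge_at_top[of 2]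
    unfolding assms(5) by eventually_elim (rule vertex_set.edgelighter_mixing_time_ge[OF V q(1,2)])
  have upper: "\<forall>\<^sub>F n in sequentially. edgelighter_mixing_time (V n) q1 q2 \<le> 5 * (real n ^ 2 * ln n)"
    using mixing_asymptotics(3) eventually_ge_at_top[of 2]
  proof eventually_elim
    case (elim n)
    define k where "k = nat \<lceil>2 * (real n ^ 2 * ln n)\<rceil>"
    have "0 \<le> real n ^ 2 * ln n" using elim(2) by simp
    then have k: "2 * (real n ^ 2 * ln n) \<le> k" "k \<le> 2 * (real n ^ 2 * ln n) + 1"
      unfolding k_def by linarith+
    \<comment> \<open>Doubling \<open>k\<close> gives the leading coefficient 4; the coefficient 5
      absorbs the rounding and the additional step.\<close>
    have "real (edgelighter_mixing_time (V n) q1 q2) \<le> real (Suc (2 * k))"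
      using vertex_set.edgelighter_mixing_time_le[OF V q(1,2) k(1)] elim(2) by (simp only: assms(5) of_nat_le_iff)
    also have "\<dots> \<le> 2 * (2 * (real n ^ 2 * ln n) + 1) + 1"
      using k(2) by simp
    also note elim(1)
    finally show ?case .
  qed
  have pos: "\<forall>\<^sub>F n in sequentially. 0 \<le> real n ^ 2 * ln n"
    using eventually_ge_at_top[of 2] by eventually_elim simp
  show "(\<lambda>n. real (edgelighter_mixing_time (V n) q1 q2)) \<in> \<Theta>(\<lambda>n. real n ^ 2 * ln (real n))"
  proof (rule bigthetaI)
    have "\<forall>\<^sub>F n in sequentially. norm (real (edgelighter_mixing_time (V n) q1 q2)) \<le> 5 * norm (real n ^ 2 * ln (real n))"
      using upper pos by eventually_elim simp
    then show "(\<lambda>n. real (edgelighter_mixing_time (V n) q1 q2)) \<in> O(\<lambda>n. real n ^ 2 * ln (real n))"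
      by (rule bigoI)
    have "\<forall>\<^sub>F n in sequentially. norm (real n ^ 2 * ln (real n)) \<le> 64 * norm (real (edgelighter_mixing_time (V n) q1 q2))"
      using lower pos by eventually_elim simp
    then show "(\<lambda>n. real (edgelighter_mixing_time (V n) q1 q2)) \<in> \<Omega>(\<lambda>n. real n ^ 2 * ln (real n))"
      unfolding bigomega_iff_bigo by (rule bigoI)
  qed
qed

end
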